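(* Let $A$, $A_1$, $B$, $B_1$, $B_2$, $C_1$, $C_1-A_1$ and $\mathbb{Y}$ be positive stable matrices in $\mathbb{C}^{r\times r}$ with $A_1C_1=C_1A_1$, and let $z,w\in\mathbb{C}$ with $|z|<1$, $|w|<1$. Then $$F_1^{(A,B)}(A_1,B_1,B_2;C_1;z,w;\mathbb{Y})=\int_0^1{}_1F_1\!\left(A;B;-\frac{\mathbb{Y}}{u(1-u)}\right)u^{A_1-I}(1-u)^{C_1-A_1-I}\,[\mathfrak{B}(A_1,C_1-A_1)]^{-1}(1-zu)^{-B_1}(1-wu)^{-B_2}\,du .$$
   Context: A matrix in $\mathbb{C}^{r\times r}$ is positive stable if all its eigenvalues have positive real part; $I$ is the identity matrix. For a matrix $M$ and a complex number $s\notin(-\infty,0]$, $s^M=\exp(M\log s)$ with the principal logarithm. The Pochhammer symbol is $(M)_0=I$, $(M)_n=M(M+I)\cdots(M+(n-1)I)$ for $n\ge1$. For positive stable $B$ and a square matrix $W$, ${}_1F_1(A;B;W)=\sum_{n\ge0}(A)_n\,[(B)_n]^{-1}\,\frac{W^n}{n!}$. For commuting positive stable $P,Q$, the beta matrix function is $\mathfrak{B}(P,Q)=\Gamma(P)\Gamma(Q)\Gamma^{-1}(P+Q)=\int_0^1t^{P-I}(1-t)^{Q-I}dt$, where $\Gamma(P)=\int_0^\infty e^{-t}t^{P-I}dt$. For positive stable $A,B,P,Q,\mathbb{Y}$, $$\mathfrak{B}_{\mathbb{Y}}^{(A,B)}(P,Q)=\int_0^1 {}_1F_1\!\left(A;B;-\frac{\mathbb{Y}}{t(1-t)}\right)t^{P-I}(1-t)^{Q-I}\,dt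 .$$ The new extended Appell matrix function is $$F_1^{(A,B)}(A_1,B_1,B_2;C_1;z,w;\mathbb{Y})=\sum_{m,n\ge0}\mathfrak{B}_{\mathbb{Y}}^{(A,B)}(A_1+(m+n)I,C_1-A_1)\,[\mathfrak{B}(A_1,C_1-A_1)]^{-1}(B_1)_m(B_2)_n\frac{z^mw^n}{m!\,n!}.$$ *)

theory Defs
  imports "HOL-Analysis.Analysis"
begin

(* Square matrices are complex ^ 'r ^ 'r with product **.  On this type the library's * and ^
   act entrywise and exp is not available, so powers and the exponential are defined here. *)

definition eigenvalue :: "complex ^ 'r ^ 'r \<Rightarrow> complex \<Rightarrow> bool" where
  "eigenvalue M l \<longleftrightarrow> (\<exists>v. v \<noteq> 0 \<and> M *v v = l *s v)"

definition positive_stable :: "complex ^ 'r ^ 'r \<Rightarrow> bool" where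
  "positive_stable M \<longleftrightarrow> (\<forall>l. eigenvalue M l \<longrightarrow> Re l > 0)"

definition mat_scale :: "complex \<Rightarrow> complex ^ 'r ^ 'r \<Rightarrow> complex ^ 'r ^ 'r" where
  "mat_scale c M = (\<chi> i j. c * M $ i $ j)"

primrec mat_pow :: "complex ^ 'r ^ 'r \<Rightarrow> nat \<Rightarrow> complex ^ 'r ^ 'r" where
  "mat_pow M 0 = mat 1"
| "mat_pow M (Suc n) = mat_pow M n ** M"

definition mat_exp :: "complex ^ 'r ^ 'r \<Rightarrow> complex ^ 'r ^ 'r" where
  "mat_exp M = (\<Sum>n. mat_pow M n /\<^sub>R fact n)"

(* s ^ M, for s off the closed negative real axis *)
definition mat_cpow :: "complex \<Rightarrow> complex ^ 'r ^ 'r \<Rightarrow> complex ^ 'r ^ 'r" where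
  "mat_cpow s M = mat_exp (mat_scale (Ln s) M)"

primrec mat_poch :: "complex ^ 'r ^ 'r \<Rightarrow> nat \<Rightarrow> complex ^ 'r ^ 'r" where
  "mat_poch M 0 = mat 1"
| "mat_poch M (Suc n) = mat_poch M n ** (M + mat (of_nat n))"

definition mat_1F1 ::
  "complex ^ 'r ^ 'r \<Rightarrow> complex ^ 'r ^ 'r \<Rightarrow> complex ^ 'r ^ 'r \<Rightarrow> complex ^ 'r ^ 'r" where
  "mat_1F1 A B W = (\<Sum>n. (mat_poch A n ** matrix_inv (mat_poch B n) ** mat_pow W n) /\<^sub>R fact n)"

definition mat_Gamma :: "complex ^ 'r ^ 'r \<Rightarrow> complex ^ 'r ^ 'r" where
  "mat_Gamma P = (LINT t:{0<..}|lborel. exp (- t) *\<^sub>R mat_cpow (of_real t) (P - mat 1))"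

definition mat_Beta :: "complex ^ 'r ^ 'r \<Rightarrow> complex ^ 'r ^ 'r \<Rightarrow> complex ^ 'r ^ 'r" where
  "mat_Beta P Q = mat_Gamma P ** mat_Gamma Q ** matrix_inv (mat_Gamma (P + Q))"

(* 1F1(A; B; -Y/(t(1-t))) t^(P-I) (1-t)^(Q-I) *)
definition ext_Beta_integrand ::
  "complex ^ 'r ^ 'r \<Rightarrow> complex ^ 'r ^ 'r \<Rightarrow> complex ^ 'r ^ 'r \<Rightarrow> complex ^ 'r ^ 'r
    \<Rightarrow> complex ^ 'r ^ 'r \<Rightarrow> real \<Rightarrow> complex ^ 'r ^ 'r" where
  "ext_Beta_integrand A B Y P Q t =
     mat_1F1 A B (- (Y /\<^sub>R (t * (1 - t))))
       ** mat_cpow (of_real t) (P - mat 1) ** mat_cpow (of_real (1 - t)) (Q - mat 1)"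

definition ext_Beta ::
  "complex ^ 'r ^ 'r \<Rightarrow> complex ^ 'r ^ 'r \<Rightarrow> complex ^ 'r ^ 'r \<Rightarrow> complex ^ 'r ^ 'r
    \<Rightarrow> complex ^ 'r ^ 'r \<Rightarrow> complex ^ 'r ^ 'r" where
  "ext_Beta A B Y P Q = (LINT t:{0<..<1}|lborel. ext_Beta_integrand A B Y P Q t)"

definition ext_Appell_F1_term ::
  "complex ^ 'r ^ 'r \<Rightarrow> complex ^ 'r ^ 'r \<Rightarrow> complex ^ 'r ^ 'r \<Rightarrow> complex ^ 'r ^ 'r
    \<Rightarrow> complex ^ 'r ^ 'r \<Rightarrow> complex ^ 'r ^ 'r \<Rightarrow> complex \<Rightarrow> complex \<Rightarrow> complex ^ 'r ^ 'r
    \<Rightarrow> nat \<times> nat \<Rightarrow> complex ^ 'r ^ 'r" where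
  "ext_Appell_F1_term A B A1 B1 B2 C1 z w Y = (\<lambda>(m, n).
     mat_scale (z ^ m * w ^ n / (fact m * fact n))
       (ext_Beta A B Y (A1 + mat (of_nat (m + n))) (C1 - A1)
          ** matrix_inv (mat_Beta A1 (C1 - A1)) ** mat_poch B1 m ** mat_poch B2 n))"

definition ext_Appell_F1 ::
  "complex ^ 'r ^ 'r \<Rightarrow> complex ^ 'r ^ 'r \<Rightarrow> complex ^ 'r ^ 'r \<Rightarrow> complex ^ 'r ^ 'r
    \<Rightarrow> complex ^ 'r ^ 'r \<Rightarrow> complex ^ 'r ^ 'r \<Rightarrow> complex \<Rightarrow> complex \<Rightarrow> complex ^ 'r ^ 'r
    \<Rightarrow> complex ^ 'r ^ 'r" where
  "ext_Appell_F1 A B A1 B1 B2 C1 z w Y =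
     infsum (ext_Appell_F1_term A B A1 B1 B2 C1 z w Y) UNIV"

end

theory Submission
  imports Defs "HOL-Complex_Analysis.Complex_Analysis" "HOL-Computational_Algebra.Fundamental_Theorem_Algebra"
begin

text \<open>
  For \<open>0 < u < 1\<close> the powers of \<open>1 - z u\<close> and \<open>1 - w u\<close> are binomial series in \<open>u\<close>, and the factor
  \<open>u ^ (m + n)\<close> shifts the exponent \<open>A1 - I\<close>, so the identity is termwise integration.  The dominating
  function is the integrand of the extended beta function; it is integrable because
  \<open>1F1(A; B; - s Y)\<close> stays bounded for \<open>s \<ge> 0\<close>, although \<open>A\<close>, \<open>B\<close>, \<open>Y\<close> need not commute.
  For a positive stable \<open>M\<close>, Newton interpolation at the roots of an annihilating polynomial and the maximum
  modulus principle give a linear functional calculus \<open>f \<mapsto> f(M)\<close> bounded by the supremum of \<open>|f|\<close> over a disc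
  in the right half plane.  Applied in turn to \<open>A\<close>, \<open>B\<close> and \<open>Y\<close>, it reduces the bound to the scalar
  function, uniformly for parameters in compact subsets of the right half plane; there it follows from a
  Lyapunov function for Kummer's differential equation.
\<close>

subsection \<open>Matrix algebra and annihilating polynomials\<close>

text \<open>The obstacle is cancellation. Near the ends of the interval the argument of
  \<open>mat_1F1\<close> grows like \<open>1 / t\<close> or \<open>1 / (1 - t)\<close>, and norms
  taken term by term in its series give only an exponential bound in that argument, which is not
  integrable. The estimate must therefore be made on whole partial sums. What permits this is that
  each term is a product of a function of \<open>A\<close>, a function of \<open>B\<close> and a
  power of \<open>Y\<close> in this fixed order, and that a matrix product is linear in each factor:
  each matrix can be traded for a scalar by its own calculus while the others are held fixed. For
  this a calculus needs little more than linearity, a rule for multiplication by the variable and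
  the supremum bound. On the scalar side a Lyapunov function is preferred to asymptotics because its
  constants depend only on a lower bound \<open>\<epsilon>\<close> for the real parts and an upper
  bound \<open>R\<close> for the moduli of the parameters.\<close>

lemma bounded_bilinear_matrix_mult:
  "bounded_bilinear ((**) :: complex^'n^'m \<Rightarrow> complex^'k^'n \<Rightarrow> complex^'k^'m)"
proof -
  have "bilinear ((**) :: complex^'n^'m \<Rightarrow> complex^'k^'n \<Rightarrow> complex^'k^'m)"
    by (auto simp: bilinear_def linear_iff matrix_matrix_mult_def vec_eq_iff
        distrib_left distrib_right sum.distrib scaleR_sum_right)
  then show ?thesis
    by (simp add: bilinear_conv_bounded_bilinear)
qed

interpretation mm: bounded_bilinear "(**) :: complex^'n^'m \<Rightarrow> complex^'k^'n \<Rightarrow> complex^'k^'m"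
  by (rule bounded_bilinear_matrix_mult)

lemma bounded_bilinear_mat_scale: "bounded_bilinear (mat_scale :: complex \<Rightarrow> complex^'n^'n \<Rightarrow> _)"
proof -
  have "bilinear (mat_scale :: complex \<Rightarrow> complex^'n^'n \<Rightarrow> _)"
    by (auto simp: bilinear_def linear_iff mat_scale_def vec_eq_iff algebra_simps)
  then show ?thesis
    by (simp add: bilinear_conv_bounded_bilinear)
qed

interpretation ms: bounded_bilinear "mat_scale :: complex \<Rightarrow> complex^'n^'n \<Rightarrow> _"
  by (rule bounded_bilinear_mat_scale)

lemma mat_scale_nth: "mat_scale c X $ i $ j = c * X $ i $ j"
  by (simp add: mat_scale_def)

lemma norm_mat_scale: "norm (mat_scale c (X :: complex^'n^'n)) = norm c * norm X"
proof -
  have "norm (mat_scale c X $ i) = norm c * norm (X $ i)" for i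
    by (simp add: norm_vec_def L2_set_def mat_scale_nth norm_mult power_mult_distrib
        real_sqrt_mult flip: sum_distrib_left)
  then show ?thesis
    by (simp add: norm_vec_def L2_set_def power_mult_distrib real_sqrt_mult flip: sum_distrib_left)
qed

lemma mat_scale_one [simp]: "mat_scale 1 X = X"
  by (simp add: mat_scale_def vec_eq_iff)

lemma mat_scale_scale [simp]: "mat_scale c (mat_scale d X) = mat_scale (c * d) X"
  by (simp add: mat_scale_def vec_eq_iff)

lemma mat_scale_mult_left [simp]: "mat_scale c X ** Z = mat_scale c (X ** Z)"
  by (simp add: mat_scale_def vec_eq_iff matrix_matrix_mult_def sum_distrib_left mult.assoc)

lemma mat_scale_mult_right [simp]: "X ** mat_scale c Z = mat_scale c (X ** Z)"
  by (simp add: mat_scale_def vec_eq_iff matrix_matrix_mult_def sum_distrib_left mult_ac)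

lemma mat_eq_mat_scale: "mat c = mat_scale c (mat 1)"
  by (simp add: mat_scale_def vec_eq_iff mat_def)

lemma scaleR_eq_mat_scale: "r *\<^sub>R X = mat_scale (complex_of_real r) X"
proof -
  have "r *\<^sub>R x = complex_of_real r * x" for x
    by (simp add: scaleR_conv_of_real)
  then show ?thesis
    by (simp add: mat_scale_def vec_eq_iff)
qed

lemma mat_scale_vector: "mat_scale c X *v v = c *s (X *v v)"
  by (simp add: mat_scale_def vec_eq_iff matrix_vector_mult_def sum_distrib_left mult.assoc)

lemma mat_scale_cancel_zero: "c \<noteq> 0 \<Longrightarrow> mat_scale c X = 0 \<Longrightarrow> X = 0"
  by (auto simp: mat_scale_def vec_eq_iff)

lemma mat_pow_scale: "mat_pow (mat_scale c M) n = mat_scale (c ^ n) (mat_pow M n)"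
  by (induction n) (simp_all add: mult.commute)

definition mat_poly :: "complex poly \<Rightarrow> complex^'n^'n \<Rightarrow> complex^'n^'n" where
  "mat_poly p M = (\<Sum>i\<le>degree p. mat_scale (coeff p i) (mat_pow M i))"

lemma mat_poly_altdef:
  assumes "degree p \<le> n"
  shows "mat_poly p M = (\<Sum>i\<le>n. mat_scale (coeff p i) (mat_pow M i))"
  unfolding mat_poly_def
  by (rule sum.mono_neutral_left) (use assms in \<open>auto simp: coeff_eq_0 ms.zero_left not_le\<close>)

lemma mat_poly_linear_factor: "mat_poly ([:- l, 1:] * q) M = mat_poly q M ** (M - mat l)"
proof -
  let ?p = "[:- l, 1:] * q"
  define n where "n = degree q"
  have deg: "degree ?p \<le> Suc n"
    using degree_mult_le[of "[:- l, 1:]" q] by (simp add: n_def)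
  have coeff: "coeff ?p i = (case i of 0 \<Rightarrow> 0 | Suc j \<Rightarrow> coeff q j) - l * coeff q i" for i
    by (cases i) (auto simp: mult_pCons_left)
  have "mat_poly ?p M = (\<Sum>i\<le>Suc n. mat_scale (case i of 0 \<Rightarrow> 0 | Suc j \<Rightarrow> coeff q j) (mat_pow M i))
     - (\<Sum>i\<le>Suc n. mat_scale (l * coeff q i) (mat_pow M i))"
    unfolding mat_poly_altdef[OF deg] coeff ms.diff_left sum_subtractf ..
  also have "(\<Sum>i\<le>Suc n. mat_scale (case i of 0 \<Rightarrow> 0 | Suc j \<Rightarrow> coeff q j) (mat_pow M i))
      = mat_poly q M ** M"
    by (subst sum.atMost_Suc_shift) (simp add: ms.zero_left mm.sum_left mat_poly_def n_def)
  also have "(\<Sum>i\<le>Suc n. mat_scale (l * coeff q i) (mat_pow M i)) = mat_poly q M ** mat l"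
    by (subst mat_eq_mat_scale)
      (simp add: mat_poly_def n_def ms.zero_left ms.sum_right coeff_eq_0)
  finally show ?thesis
    by (simp add: mm.diff_right)
qed


text \<open>The space of matrices has real dimension \<open>N\<close>, so the \<open>N + 1\<close>
  powers of \<open>M\<close> up to exponent \<open>N\<close> satisfy a nontrivial linear relation.
  Dependence is a property of sets, hence the case split: if two powers coincide, their difference
  is the relation.\<close>

lemma ex_mat_poly_zero: "\<exists>p. p \<noteq> 0 \<and> mat_poly p (M :: complex^'n^'n) = 0"
proof -
  define N where "N = DIM(complex^'n^'n)"
  have "\<exists>c :: nat \<Rightarrow> real. (\<exists>i\<le>N. c i \<noteq> 0) \<and> (\<Sum>i\<le>N. c i *\<^sub>R mat_pow M i) = 0"
  proof (cases "inj_on (mat_pow M) {..N}")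
    case True
    have "DIM(complex^'n^'n) < card (mat_pow M ` {..N})"
      unfolding card_image[OF True] card_atMost unfolding N_def by (rule lessI)
    then have "dependent (mat_pow M ` {..N})"
      by (intro dependent_biggerset) simp
    then obtain u where u: "\<exists>v\<in>mat_pow M ` {..N}. u v \<noteq> 0" "(\<Sum>v\<in>mat_pow M ` {..N}. u v *\<^sub>R v) = 0"
      using dependent_finite[of "mat_pow M ` {..N}"] by blast
    have "(\<Sum>i\<le>N. u (mat_pow M i) *\<^sub>R mat_pow M i) = 0"
      using u(2) by (simp add: sum.reindex[OF True])
    with u(1) show ?thesis
      by (intro exI[of _ "\<lambda>i. u (mat_pow M i)"]) auto
  next
    case False
    then obtain i j where ij: "i \<le> N" "j \<le> N" "i \<noteq> j" "mat_pow M i = mat_pow M j"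
      by (auto simp: inj_on_def)
    define c :: "nat \<Rightarrow> real" where "c = (\<lambda>k. (if k = i then 1 else 0) - (if k = j then 1 else 0))"
    have "(\<Sum>k\<le>N. c k *\<^sub>R mat_pow M k)
        = (\<Sum>k\<le>N. if k = i then mat_pow M k else 0) - (\<Sum>k\<le>N. if k = j then mat_pow M k else 0)"
      unfolding sum_subtractf [symmetric] by (rule sum.cong) (auto simp: c_def)
    also have "\<dots> = 0"
      using ij by (simp add: sum.delta)
    finally show ?thesis
      using ij(1,3) by (intro exI[of _ c] conjI exI[of _ i]) (simp_all add: c_def)
  qed
  then obtain c i where c: "i \<le> N" "c i \<noteq> 0" "(\<Sum>i\<le>N. c i *\<^sub>R mat_pow M i) = 0"
    by auto
  define p where "p = (\<Sum>i\<le>N. monom (complex_of_real (c i)) i)"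
  have coeff: "coeff p k = (if k \<le> N then of_real (c k) else 0)" for k
    by (simp add: p_def coeff_sum sum.delta')
  have "degree p \<le> N"
    by (rule degree_le) (simp add: coeff)
  then have "mat_poly p M = (\<Sum>i\<le>N. mat_scale (coeff p i) (mat_pow M i))"
    by (rule mat_poly_altdef)
  also have "\<dots> = (\<Sum>i\<le>N. c i *\<^sub>R mat_pow M i)"
    by (rule sum.cong) (simp_all add: coeff scaleR_eq_mat_scale)
  finally have "mat_poly p M = 0"
    using c(3) by simp
  moreover have "coeff p i \<noteq> 0"
    using c(1,2) by (simp add: coeff)
  then have "p \<noteq> 0"
    by (metis coeff_0)
  ultimately show ?thesis
    by (intro exI[of _ p] conjI)
qed

text \<open>A list of roots instead of a polynomial keeps multiplicities and an order of the nodes;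
  the factor of the head stands on the right, in step with the recursion of
  \<open>newton_calc\<close>.\<close>

primrec mat_prod :: "complex^'n^'n \<Rightarrow> complex list \<Rightarrow> complex^'n^'n" where
  "mat_prod M [] = mat 1"
| "mat_prod M (l # ls) = mat_prod M ls ** (M - mat l)"

lemma mat_diff_commute: "(M - mat k) ** (M - mat l) = (M - mat l) ** (M - mat k)" for M :: "complex^'n^'n"
proof -
  have c: "mat a ** N = N ** mat a" for a and N :: "complex^'n^'n"
    unfolding mat_eq_mat_scale[of a] by simp
  show ?thesis
    unfolding mm.diff_left mm.diff_right c[of k] c[of l M] by simp
qed

lemma mat_prod_commute: "mat_prod M ls ** (M - mat l) = (M - mat l) ** mat_prod M ls"
proof (induction ls)
  case (Cons k ls)
  have "mat_prod M (k # ls) ** (M - mat l) = mat_prod M ls ** ((M - mat l) ** (M - mat k))"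
    by (simp add: matrix_mul_assoc [symmetric] mat_diff_commute[of M k l])
  also have "\<dots> = (M - mat l) ** mat_prod M (k # ls)"
    by (simp add: matrix_mul_assoc Cons.IH)
  finally show ?case .
qed simp

lemma mat_poly_factorization:
  "p \<noteq> 0 \<Longrightarrow> \<exists>c ls. c \<noteq> 0 \<and> mat_poly p M = mat_scale c (mat_prod M ls)"
proof (induction "degree p" arbitrary: p)
  case 0
  then obtain c where "p = [:c:]" "c \<noteq> 0"
    by (metis degree_eq_zeroE pCons_0_0)
  then show ?case
    by (intro exI[of _ c] exI[of _ "[]"]) (auto simp: mat_poly_def)
next
  case (Suc n)
  then obtain l where "poly p l = 0"
    by (metis Zero_not_Suc constant_degree fundamental_theorem_of_algebra)
  then obtain q where q: "p = [:- l, 1:] * q"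
    by (metis poly_eq_0_iff_dvd dvdE)
  with Suc.prems have "q \<noteq> 0" by auto
  then have "degree p = Suc (degree q)"
    unfolding q by (subst degree_mult_eq) auto
  with Suc.hyps(2) have "n = degree q"
    by simp
  with Suc.hyps(1) \<open>q \<noteq> 0\<close> obtain c ls
    where c: "c \<noteq> 0" "mat_poly q M = mat_scale c (mat_prod M ls)"
    by blast
  have "mat_poly p M = mat_scale c (mat_prod M (l # ls))"
    unfolding q mat_poly_linear_factor c(2) by simp
  with c(1) show ?case
    by blast
qed

text \<open>If some \<open>X *v v\<close> were nonzero, it would be an eigenvector for
  \<open>l\<close>.\<close>

lemma mat_diff_cancel:
  assumes "\<not> eigenvalue M l" "(M - mat l) ** X = 0"
  shows "X = 0"
proof -
  have "X *v v = 0" for v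
  proof (rule ccontr)
    assume "X *v v \<noteq> 0"
    moreover have "(M - mat l) *v (X *v v) = 0"
      by (simp add: matrix_vector_mul_assoc assms(2))
    then have "M *v (X *v v) = l *s (X *v v)"
      by (subst (asm) mat_eq_mat_scale) (simp add: matrix_vector_mult_diff_rdistrib mat_scale_vector)
    ultimately show False
      using assms(1) by (auto simp: eigenvalue_def)
  qed
  then show ?thesis
    by (metis matrix_eq matrix_vector_mult_0)
qed

text \<open>A factor \<open>M - mat l\<close> for a non-eigenvalue is injective. The factors
  commute, so it can be moved to the front and cancelled; the right factor \<open>X\<close> is there
  to let the induction absorb the head of the list.\<close>

lemma mat_prod_filter_eigenvalue:
  "mat_prod M ls ** X = 0 \<Longrightarrow> mat_prod M (filter (eigenvalue M) ls) ** X = 0"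
proof (induction ls arbitrary: X)
  case Nil
  then show ?case by simp
next
  case (Cons l ls)
  let ?P = "mat_prod M (filter (eigenvalue M) ls)"
  have "mat_prod M ls ** ((M - mat l) ** X) = 0"
    using Cons.prems unfolding mat_prod.simps matrix_mul_assoc .
  then have "?P ** ((M - mat l) ** X) = 0"
    by (rule Cons.IH)
  then have IH: "(?P ** (M - mat l)) ** X = 0"
    unfolding matrix_mul_assoc .
  show ?case
  proof (cases "eigenvalue M l")
    case True
    then show ?thesis
      using IH by simp
  next
    case False
    have "(M - mat l) ** (?P ** X) = 0"
      using IH unfolding matrix_mul_assoc mat_prod_commute .
    then have "?P ** X = 0"
      by (rule mat_diff_cancel[OF False])
    with False show ?thesis
      by simp
  qed
qed


text \<open>Keeping only eigenvalues is what places all nodes in the right half plane when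
  \<open>M\<close> is positive stable. The list is nonempty because the empty product is the
  identity; this matters because \<open>newton_calc\<close> is zero on the empty list, even for
  constants.\<close>

lemma ex_annihilating_eigenvalues:
  fixes M :: "complex^'n^'n"
  obtains ls where "ls \<noteq> []" "\<And>l. l \<in> set ls \<Longrightarrow> eigenvalue M l" "mat_prod M ls = 0"
proof -
  obtain p where p: "p \<noteq> 0" "mat_poly p M = 0"
    using ex_mat_poly_zero[of M] by (elim exE conjE)
  obtain c ls where c: "c \<noteq> 0" "mat_poly p M = mat_scale c (mat_prod M ls)"
    using mat_poly_factorization[OF p(1), of M] by (elim exE conjE)
  have "mat_prod M ls = 0"
    by (rule mat_scale_cancel_zero[OF c(1) trans[OF c(2)[symmetric] p(2)]])
  then have z: "mat_prod M (filter (eigenvalue M) ls) = 0"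
    using mat_prod_filter_eigenvalue[of M ls "mat 1"] by simp
  have "(mat 1 :: complex^'n^'n) $ i $ i \<noteq> 0" for i
    by (simp add: mat_def)
  then have nz: "(mat 1 :: complex^'n^'n) \<noteq> 0"
    by (intro notI) simp
  have ne: "filter (eigenvalue M) ls \<noteq> []"
  proof
    assume "filter (eigenvalue M) ls = []"
    with z have "(mat 1 :: complex^'n^'n) = 0"
      by (simp only: mat_prod.simps)
    with nz show False ..
  qed
  show ?thesis
    by (rule that[OF ne _ z]) simp
qed

subsection \<open>A holomorphic functional calculus for positive stable matrices\<close>

abbreviation right_half_plane :: "complex set" where
  "right_half_plane \<equiv> {x. Re x > 0}"

lemma open_right_half_plane: "open right_half_plane"
  by (rule open_halfspace_Re_gt)

text \<open>The value \<open>deriv f l\<close> fills the removable singularity, so the quotient is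
  holomorphic again and can be divided at the same point once more; repeated nodes then need no
  special treatment.\<close>

definition divided_diff :: "complex \<Rightarrow> (complex \<Rightarrow> complex) \<Rightarrow> complex \<Rightarrow> complex" where
  "divided_diff l f = (\<lambda>z. if z = l then deriv f l else (f z - f l) / (z - l))"

lemma holomorphic_divided_diff:
  "f holomorphic_on right_half_plane \<Longrightarrow> divided_diff l f holomorphic_on right_half_plane"
  unfolding divided_diff_def by (rule pole_lemma_open[OF _ open_right_half_plane])

lemma right_half_plane_field_differentiable:
  "f holomorphic_on right_half_plane \<Longrightarrow> Re l > 0 \<Longrightarrow> f field_differentiable (at l)"
  by (rule holomorphic_on_imp_differentiable_at[OF _ open_right_half_plane]) auto

lemma divided_diff_add:
  assumes "f holomorphic_on right_half_plane" "g holomorphic_on right_half_plane" "Re l > 0"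
  shows "divided_diff l (\<lambda>x. f x + g x) = (\<lambda>x. divided_diff l f x + divided_diff l g x)"
  using assms
  by (auto simp: divided_diff_def fun_eq_iff deriv_add right_half_plane_field_differentiable
      add_divide_distrib diff_divide_distrib)

lemma divided_diff_cmult:
  assumes "f holomorphic_on right_half_plane" "Re l > 0"
  shows "divided_diff l (\<lambda>x. c * f x) = (\<lambda>x. c * divided_diff l f x)"
  using assms
  by (auto simp: divided_diff_def fun_eq_iff deriv_cmult right_half_plane_field_differentiable
      right_diff_distrib)

text \<open>Away from \<open>l\<close> this is
  \<open>f x * x - f l * l = f l * (x - l) + (f x - f l) * x\<close> divided by
  \<open>x - l\<close>; at \<open>l\<close> it is the product rule.\<close>

lemma divided_diff_mult_ident:
  assumes "f holomorphic_on right_half_plane" "Re l > 0"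
  shows "divided_diff l (\<lambda>x. f x * x) = (\<lambda>x. f l + divided_diff l f x * x)"
proof
  fix x
  have "deriv (\<lambda>x. f x * x) l = f l + deriv f l * l"
    using assms by (subst deriv_mult) (auto simp: right_half_plane_field_differentiable)
  then show "divided_diff l (\<lambda>x. f x * x) x = f l + divided_diff l f x * x"
    by (auto simp: divided_diff_def divide_simps) (auto simp: algebra_simps)
qed

text \<open>The Newton form of the Hermite interpolation polynomial of \<open>f\<close> at the
  listed nodes, evaluated at \<open>M\<close>. It represents \<open>f(M)\<close> as soon as the
  product of the \<open>M - mat l\<close> over the nodes vanishes.\<close>

primrec newton_calc :: "complex^'n^'n \<Rightarrow> complex list \<Rightarrow> (complex \<Rightarrow> complex) \<Rightarrow> complex^'n^'n" where
  "newton_calc M [] f = 0"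
| "newton_calc M (l # ls) f = mat (f l) + newton_calc M ls (divided_diff l f) ** (M - mat l)"

lemma mat_add: "mat (a + b) = (mat a + mat b :: complex^'n^'n)"
  by (simp add: mat_def vec_eq_iff)

lemma mat_scale_mat: "mat_scale c (mat a) = mat (c * a)"
  by (simp add: mat_scale_def mat_def vec_eq_iff)

lemma mat_mult_mat: "(mat a :: complex^'n^'n) ** mat b = (mat (a * b) :: complex^'n^'n)"
proof -
  have "mat_scale a (mat 1 :: complex^'n^'n) ** mat b = mat_scale a (mat b)"
    by simp
  then show ?thesis
    by (simp only: mat_scale_mat mult_1_right)
qed

lemma newton_calc_add:
  assumes "\<And>l. l \<in> set ls \<Longrightarrow> Re l > 0"
    and "f holomorphic_on right_half_plane" "g holomorphic_on right_half_plane"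
  shows "newton_calc M ls (\<lambda>x. f x + g x) = newton_calc M ls f + newton_calc M ls g"
  using assms
proof (induction ls arbitrary: f g)
  case (Cons l ls)
  have l: "Re l > 0"
    using Cons.prems(1) by simp
  have "newton_calc M ls (\<lambda>x. divided_diff l f x + divided_diff l g x)
      = newton_calc M ls (divided_diff l f) + newton_calc M ls (divided_diff l g)"
    using Cons.prems by (intro Cons.IH holomorphic_divided_diff) auto
  then show ?case
    by (simp add: divided_diff_add[OF Cons.prems(2,3) l] mat_add mm.add_left)
qed simp

lemma newton_calc_cmult:
  assumes "\<And>l. l \<in> set ls \<Longrightarrow> Re l > 0" and "f holomorphic_on right_half_plane"
  shows "newton_calc M ls (\<lambda>x. c * f x) = mat_scale c (newton_calc M ls f)"
  using assms
proof (induction ls arbitrary: f)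
  case (Cons l ls)
  have l: "Re l > 0"
    using Cons.prems(1) by simp
  have "newton_calc M ls (\<lambda>x. c * divided_diff l f x) = mat_scale c (newton_calc M ls (divided_diff l f))"
    using Cons.prems by (intro Cons.IH holomorphic_divided_diff) auto
  then show ?case
    by (simp add: divided_diff_cmult[OF Cons.prems(2) l] ms.add_right mat_scale_mat)
qed (simp add: ms.zero_right)

lemma newton_calc_zero: "newton_calc M ls (\<lambda>x. 0) = 0"
proof (induction ls)
  case (Cons l ls)
  moreover have "divided_diff l (\<lambda>x. 0) = (\<lambda>x. 0)"
    by (auto simp: divided_diff_def)
  ultimately show ?case by simp
qed simp

lemma newton_calc_const: "ls \<noteq> [] \<Longrightarrow> newton_calc M ls (\<lambda>x. c) = mat c"
proof (cases ls)
  case (Cons l ls')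
  have "divided_diff l (\<lambda>x. c) = (\<lambda>x. 0)"
    by (auto simp: divided_diff_def)
  then show ?thesis
    by (simp add: Cons newton_calc_zero)
qed simp

text \<open>The interpolant of \<open>f x * x\<close> and \<open>x\<close> times the interpolant of
  \<open>f\<close> agree at the nodes with multiplicity, and neither has degree above the number of
  nodes; so they differ by a constant multiple of the node polynomial. This error disappears when
  the nodes annihilate \<open>M\<close>.\<close>

lemma newton_calc_mult_ident:
  assumes "\<And>l. l \<in> set ls \<Longrightarrow> Re l > 0" and "f holomorphic_on right_half_plane" and "ls \<noteq> []"
  shows "\<exists>c. newton_calc M ls (\<lambda>x. f x * x) = newton_calc M ls f ** M - mat_scale c (mat_prod M ls)"
  using assms
proof (induction ls arbitrary: f)
  case (Cons l ls)
  have l: "Re l > 0"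
    using Cons.prems(1) by simp
  define g where "g = divided_diff l f"
  have g: "g holomorphic_on right_half_plane"
    unfolding g_def by (rule holomorphic_divided_diff[OF Cons.prems(2)])
  have dd: "divided_diff l (\<lambda>x. f x * x) = (\<lambda>x. f l + g x * x)"
    unfolding g_def by (rule divided_diff_mult_ident[OF Cons.prems(2) l])
  have comm: "mat a ** N = N ** mat a" for a and N :: "complex^'n^'n"
    unfolding mat_eq_mat_scale[of a] by simp
  have MM: "(M - mat l) ** M = M ** (M - mat l)"
    by (simp add: mm.diff_left mm.diff_right comm)
  show ?case
  proof (cases "ls = []")
    case True
    have "newton_calc M (l # ls) (\<lambda>x. f x * x) = newton_calc M (l # ls) f ** M - mat_scale (f l) (mat_prod M (l # ls))"
      by (simp add: True ms.diff_right mat_scale_mat)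
        (simp add: mat_eq_mat_scale[of "f l"])
    then show ?thesis by blast
  next
    case False
    obtain c where c: "newton_calc M ls (\<lambda>x. g x * x) = newton_calc M ls g ** M - mat_scale c (mat_prod M ls)"
      using Cons.IH[OF _ g False] Cons.prems(1) by auto
    have "newton_calc M ls (\<lambda>x. f l + g x * x) = mat (f l) + newton_calc M ls (\<lambda>x. g x * x)"
      using Cons.prems(1) False g
      by (subst newton_calc_add) (auto simp: newton_calc_const intro!: holomorphic_intros)
    then have "newton_calc M (l # ls) (\<lambda>x. f x * x)
        = mat (f l * l) + (mat (f l) + (newton_calc M ls g ** M - mat_scale c (mat_prod M ls))) ** (M - mat l)"
      by (simp add: dd c)
    also have "\<dots> = mat (f l * l) + mat (f l) ** (M - mat l) + newton_calc M ls g ** (M ** (M - mat l))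
        - mat_scale c (mat_prod M (l # ls))"
      by (simp add: mm.add_left mm.diff_left matrix_mul_assoc)
    also have "newton_calc M ls g ** (M ** (M - mat l)) = newton_calc M ls g ** (M - mat l) ** M"
      by (simp add: MM[symmetric] matrix_mul_assoc)
    also have "mat (f l * l) + mat (f l) ** (M - mat l) = mat (f l) ** M"
    proof -
      show ?thesis
        by (simp add: mm.diff_right mat_mult_mat)
    qed
    also have "mat (f l) ** M + newton_calc M ls g ** (M - mat l) ** M = newton_calc M (l # ls) f ** M"
      by (simp add: g_def mm.add_left)
    finally show ?thesis
      by blast
  qed
qed simp

text \<open>One divided difference costs only a factor \<open>2 / d\<close>, where \<open>d\<close>
  is the distance from the node to the boundary circle: there the numerator is at most
  \<open>2 * C\<close> and the denominator at least \<open>d\<close>, and the maximum principle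
  carries the bound inside, across the removable singularity at \<open>l\<close>. The constant
  depends on \<open>M\<close>, the nodes and the disc, not on \<open>f\<close>.\<close>

lemma newton_calc_bound:
  fixes M :: "complex^'n^'n"
  assumes "\<And>l. l \<in> set ls \<Longrightarrow> l \<in> ball c r" and "cball c r \<subseteq> right_half_plane"
  shows "\<exists>K\<ge>0. \<forall>f C. f holomorphic_on right_half_plane \<longrightarrow> (\<forall>x\<in>cball c r. norm (f x) \<le> C)
    \<longrightarrow> norm (newton_calc M ls f) \<le> K * C"
  using assms(1)
proof (induction ls)
  case Nil
  then show ?case
    by (intro exI[of _ 0]) simp
next
  case (Cons l ls)
  have "\<exists>K\<ge>0. \<forall>f C. f holomorphic_on right_half_plane \<longrightarrow> (\<forall>x\<in>cball c r. norm (f x) \<le> C)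
    \<longrightarrow> norm (newton_calc M ls f) \<le> K * C"
    by (rule Cons.IH, rule Cons.prems) simp
  then obtain K where K: "K \<ge> 0" "\<forall>f C. f holomorphic_on right_half_plane \<longrightarrow> (\<forall>x\<in>cball c r. norm (f x) \<le> C)
    \<longrightarrow> norm (newton_calc M ls f) \<le> K * C"
    by (elim exE conjE)
  obtain B where B: "B > 0" "\<And>X Z. norm ((X :: complex^'n^'n) ** (Z :: complex^'n^'n)) \<le> norm X * norm Z * B"
    using mm.pos_bounded[where 'n = 'n and 'm = 'n and 'k = 'n] by (elim exE conjE) blast
  define d where "d = r - dist c l"
  have d: "d > 0"
    using Cons.prems[of l] by (simp add: d_def)
  define J where "J = norm (mat 1 :: complex^'n^'n) + K * (2 / d) * norm (M - mat l) * B"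
  have "norm (newton_calc M (l # ls) f) \<le> J * C"
    if f: "f holomorphic_on right_half_plane" and C: "\<forall>x\<in>cball c r. norm (f x) \<le> C" for f C
  proof -
    have l: "l \<in> cball c r"
      using Cons.prems[of l] by simp
    have "r > 0"
      using l d by (simp add: d_def) (use zero_le_dist[of c l] in linarith)
    have "norm (divided_diff l f x) \<le> 2 / d * C" if x: "x \<in> cball c r" for x
    proof (rule maximum_modulus_frontier[OF _ _ _ _ x])
      have h: "divided_diff l f holomorphic_on right_half_plane"
        by (rule holomorphic_divided_diff[OF f])
      show "divided_diff l f holomorphic_on interior (cball c r)"
        by (rule holomorphic_on_subset[OF h]) (use assms(2) interior_subset in blast)
      show "continuous_on (closure (cball c r)) (divided_diff l f)"
        by (rule holomorphic_on_imp_continuous_on, rule holomorphic_on_subset[OF h]) (use assms(2) in simp)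
      show "bounded (cball c r)"
        by simp
      fix z assume "z \<in> frontier (cball c r)"
      then have z: "dist c z = r"
        by simp
      have "d \<le> dist z l"
        using dist_triangle2[of c z l] z by (simp add: d_def dist_commute)
      moreover have "norm (f z - f l) \<le> 2 * C"
      proof -
        have "norm (f z) \<le> C" "norm (f l) \<le> C"
          using C l z by simp_all
        then show ?thesis
          using norm_triangle_ineq4[of "f z" "f l"] by linarith
      qed
      ultimately have "norm (f z - f l) / norm (z - l) \<le> 2 * C / d"
        using d order_trans[OF norm_ge_zero, of "f z - f l" "2 * C"]
        by (intro frac_le) (auto simp: dist_norm)
      moreover have "z \<noteq> l"
        using \<open>d \<le> dist z l\<close> d by auto
      ultimately show "norm (divided_diff l f z) \<le> 2 / d * C"
        by (simp add: divided_diff_def norm_divide)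
    qed
    then have 1: "norm (newton_calc M ls (divided_diff l f)) \<le> K * (2 / d * C)"
      by (intro K(2)[rule_format] holomorphic_divided_diff f)
    have "norm (newton_calc M (l # ls) f)
        \<le> norm (mat (f l) :: complex^'n^'n) + norm (newton_calc M ls (divided_diff l f)) * norm (M - mat l) * B"
      unfolding newton_calc.simps
      by (rule order_trans[OF norm_triangle_ineq add_left_mono[OF B(2)]])
    also have "norm (mat (f l) :: complex^'n^'n) \<le> C * norm (mat 1 :: complex^'n^'n)"
      using C l by (subst mat_eq_mat_scale) (simp add: norm_mat_scale mult_right_mono)
    also have "norm (newton_calc M ls (divided_diff l f)) * norm (M - mat l) * B
        \<le> K * (2 / d * C) * norm (M - mat l) * B"
      using 1 B(1) by (intro mult_right_mono) auto
    also have "C * norm (mat 1 :: complex^'n^'n) + K * (2 / d * C) * norm (M - mat l) * B = J * C"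
      by (simp add: J_def algebra_simps)
    finally show ?thesis
      by simp
  qed
  moreover have "J \<ge> 0"
    using K(1) B(1) d by (simp add: J_def)
  ultimately show ?case
    by (intro exI[of _ J] conjI allI impI)
qed

text \<open>The discs about \<open>R\<close> of radius \<open>R - \<epsilon>\<close> fill the half
  plane \<open>Re x > \<epsilon>\<close> as \<open>R\<close> grows: in the squared condition the
  terms \<open>R^2\<close> cancel, which leaves an inequality linear in \<open>R\<close> with the
  positive coefficient \<open>2 * (Re x - \<epsilon>)\<close> on the right side.\<close>

lemma finite_subset_ball_right_half_plane:
  assumes "finite S" and "S \<subseteq> right_half_plane"
  obtains c r where "S \<subseteq> ball c r" "cball c r \<subseteq> right_half_plane"
proof -
  have "\<forall>\<^sub>F R in at_top. norm (x - of_real R) < R - \<epsilon>" if "\<epsilon> < Re x" "\<epsilon> > 0" for x :: complex and \<epsilon>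
  proof -
    have "\<forall>\<^sub>F R :: real in at_top. R > max \<epsilon> (((norm x)\<^sup>2 - \<epsilon>\<^sup>2) / (2 * (Re x - \<epsilon>)))"
      by (rule eventually_gt_at_top)
    then show ?thesis
    proof eventually_elim
      case (elim R)
      then have "(norm x)\<^sup>2 - \<epsilon>\<^sup>2 < R * (2 * (Re x - \<epsilon>))"
        using that by (simp add: pos_divide_less_eq)
      moreover have "(norm (x - of_real R))\<^sup>2 = (norm x)\<^sup>2 - 2 * R * Re x + R\<^sup>2"
        unfolding cmod_power2 by (simp add: power2_diff)
      moreover have "(R - \<epsilon>)\<^sup>2 = R\<^sup>2 - 2 * R * \<epsilon> + \<epsilon>\<^sup>2"
        by (simp add: power2_diff)
      moreover have "R * (2 * (Re x - \<epsilon>)) = 2 * R * Re x - 2 * R * \<epsilon>"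
        by (simp add: right_diff_distrib)
      ultimately have "(norm (x - of_real R))\<^sup>2 < (R - \<epsilon>)\<^sup>2"
        by linarith
      moreover have "0 \<le> R - \<epsilon>"
        using elim by simp
      ultimately show ?case
        by (rule power_less_imp_less_base)
    qed
  qed note ev = this
  obtain \<epsilon> where e: "\<epsilon> > 0" "\<And>x. x \<in> S \<Longrightarrow> \<epsilon> < Re x"
  proof -
    \<comment> \<open>Inserting \<open>1\<close> gives the minimum a meaning for an empty
      \<open>S\<close>; halving makes the inequality strict.\<close>
    define e where "e = Min (insert 1 (Re ` S)) / 2"
    have m: "Min (insert 1 (Re ` S)) > 0"
      using assms(1) subsetD[OF assms(2)] by (subst Min_gr_iff) (simp_all add: ball_simps)
    have le: "Min (insert 1 (Re ` S)) \<le> Re x" if "x \<in> S" for x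
      using assms(1) that by (intro Min_le) simp_all
    have "e < Re x" if "x \<in> S" for x
      using le[OF that] m by (simp add: e_def)
    moreover have "e > 0"
      using m by (simp add: e_def)
    ultimately show ?thesis
      by (rule that[rotated])
  qed
  have "\<forall>\<^sub>F R in at_top. \<forall>x\<in>S. norm (x - of_real R) < R - \<epsilon>"
    by (rule eventually_ball_finite[OF assms(1)], rule ballI, rule ev[OF e(2) e(1)])
  then obtain R where R: "\<forall>x\<in>S. norm (x - complex_of_real R) < R - \<epsilon>"
    using eventually_happens'[OF trivial_limit_at_top_linorder] by blast
  show ?thesis
  proof (rule that[of "of_real R" "R - \<epsilon>"])
    show "S \<subseteq> ball (of_real R) (R - \<epsilon>)"
      using R by (simp add: subset_iff dist_norm norm_minus_commute)
    have "Re x > 0" if "x \<in> cball (complex_of_real R) (R - \<epsilon>)" for x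
      using that abs_Re_le_cmod[of "of_real R - x"] e(1) by (simp add: dist_norm)
    then show "cball (complex_of_real R) (R - \<epsilon>) \<subseteq> right_half_plane"
      by blast
  qed
qed

text \<open>Multiplicativity is assumed only against the variable, with \<open>M\<close> on the
  right. This already gives powers and Pochhammer products, and together with
  \<open>calc_bound\<close> also inverses and limits of series. Compactness of \<open>D\<close>
  keeps the real parts on it away from zero.\<close>

locale holomorphic_calculus =
  fixes M :: "complex^'n^'n" and \<Phi> :: "(complex \<Rightarrow> complex) \<Rightarrow> complex^'n^'n"
    and D :: "complex set" and K :: real
  assumes compact_D: "compact D" and D_subset: "D \<subseteq> right_half_plane" and K_nonneg: "K \<ge> 0"
    and calc_add: "f holomorphic_on right_half_plane \<Longrightarrow> g holomorphic_on right_half_plane \<Longrightarrow>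
          \<Phi> (\<lambda>x. f x + g x) = \<Phi> f + \<Phi> g"
    and calc_cmult: "f holomorphic_on right_half_plane \<Longrightarrow> \<Phi> (\<lambda>x. c * f x) = mat_scale c (\<Phi> f)"
    and calc_const: "\<Phi> (\<lambda>x. c) = mat c"
    and calc_mult_ident: "f holomorphic_on right_half_plane \<Longrightarrow> \<Phi> (\<lambda>x. f x * x) = \<Phi> f ** M"
    and calc_bound: "f holomorphic_on right_half_plane \<Longrightarrow> (\<And>x. x \<in> D \<Longrightarrow> norm (f x) \<le> C) \<Longrightarrow> norm (\<Phi> f) \<le> K * C"

lemma ex_holomorphic_calculus:
  fixes M :: "complex^'n^'n"
  assumes "positive_stable M"
  obtains \<Phi> D K where "holomorphic_calculus M \<Phi> D K"
proof -
  obtain ls where ls: "ls \<noteq> []" "\<And>l. l \<in> set ls \<Longrightarrow> eigenvalue M l" "mat_prod M ls = 0"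
    by (rule ex_annihilating_eigenvalues[of M]) (rule that)
  have pos: "Re l > 0" if "l \<in> set ls" for l
    using ls(2)[OF that] assms by (simp add: positive_stable_def)
  obtain c r where cr: "set ls \<subseteq> ball c r" "cball c r \<subseteq> right_half_plane"
  proof (rule finite_subset_ball_right_half_plane[of "set ls"])
    show "set ls \<subseteq> right_half_plane"
      by (rule subsetI) (simp add: pos)
  qed simp
  obtain K where K: "K \<ge> 0" "\<forall>f C. f holomorphic_on right_half_plane \<longrightarrow> (\<forall>x\<in>cball c r. norm (f x) \<le> C)
    \<longrightarrow> norm (newton_calc M ls f) \<le> K * C"
  proof -
    have "\<exists>K\<ge>0. \<forall>f C. f holomorphic_on right_half_plane \<longrightarrow> (\<forall>x\<in>cball c r. norm (f x) \<le> C)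
        \<longrightarrow> norm (newton_calc M ls f) \<le> K * C"
      by (rule newton_calc_bound[OF _ cr(2)], rule subsetD[OF cr(1)])
    then show ?thesis
      by (elim exE conjE) (rule that)
  qed
  have "holomorphic_calculus M (newton_calc M ls) (cball c r) K"
  proof
    fix f :: "complex \<Rightarrow> complex" assume f: "f holomorphic_on right_half_plane"
    have "\<exists>c. newton_calc M ls (\<lambda>x. f x * x) = newton_calc M ls f ** M - mat_scale c (mat_prod M ls)"
      by (rule newton_calc_mult_ident[OF _ f ls(1)], rule pos)
    then show "newton_calc M ls (\<lambda>x. f x * x) = newton_calc M ls f ** M"
      unfolding ls(3) ms.zero_right by simp
  next
    show "norm (newton_calc M ls f) \<le> K * C"
      if "f holomorphic_on right_half_plane" "\<And>x. x \<in> cball c r \<Longrightarrow> norm (f x) \<le> C" for f C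
      by (rule K(2)[rule_format, OF that])
    show "newton_calc M ls (\<lambda>x. f x + g x) = newton_calc M ls f + newton_calc M ls g"
      if "f holomorphic_on right_half_plane" "g holomorphic_on right_half_plane" for f g
      by (rule newton_calc_add[OF pos that])
    show "newton_calc M ls (\<lambda>x. c * f x) = mat_scale c (newton_calc M ls f)"
      if "f holomorphic_on right_half_plane" for f c
      by (rule newton_calc_cmult[OF pos that])
    show "newton_calc M ls (\<lambda>x. c) = mat c" for c
      by (rule newton_calc_const[OF ls(1)])
  qed (rule compact_cball cr(2) K(1))+
  then show ?thesis
    by (rule that)
qed

subsection \<open>The scalar confluent hypergeometric function on rays\<close>

definition kummer_coeff :: "complex \<Rightarrow> complex \<Rightarrow> nat \<Rightarrow> complex" where
  "kummer_coeff a b n = pochhammer a n / (pochhammer b n * fact n)"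

definition kummer :: "complex \<Rightarrow> complex \<Rightarrow> complex \<Rightarrow> complex" where
  "kummer a b x = (\<Sum>n. kummer_coeff a b n * x ^ n)"

text \<open>A bound for \<open>|a + n| / |b + n|\<close> for all \<open>n\<close> when
  \<open>|a| \<le> R\<close> and \<open>\<epsilon> \<le> Re b\<close>: the entry
  \<open>R / \<epsilon>\<close> compares the constants and \<open>1\<close> compares the summands
  \<open>n\<close>. With \<open>q\<close> for this rate, the Kummer series is majorized by that of
  \<open>exp (q * r)\<close> on \<open>|x| \<le> r\<close>.\<close>

definition kummer_rate :: "real \<Rightarrow> real \<Rightarrow> real" where
  "kummer_rate \<epsilon> R = max 1 (R / \<epsilon>)"

lemma kummer_rate_ge_1: "kummer_rate \<epsilon> R \<ge> 1"
  by (simp add: kummer_rate_def)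

lemma add_of_nat_nonzero: "Re b > 0 \<Longrightarrow> b + of_nat n \<noteq> 0"
  by (auto simp: complex_eq_iff)

lemma pochhammer_nonzero: "Re b > 0 \<Longrightarrow> pochhammer b n \<noteq> 0"
  by (induction n) (simp_all add: pochhammer_Suc add_of_nat_nonzero)

lemma norm_pochhammer_le:
  fixes a b :: complex
  assumes "\<epsilon> > 0" "\<epsilon> \<le> Re b" "norm a \<le> R"
  shows "norm (pochhammer a n) \<le> kummer_rate \<epsilon> R ^ n * norm (pochhammer b n)"
proof (induction n)
  case (Suc n)
  let ?q = "kummer_rate \<epsilon> R"
  have "R \<le> ?q * \<epsilon>"
    using assms(1) by (simp add: kummer_rate_def flip: pos_divide_le_eq)
  moreover have "1 * real n \<le> ?q * real n"
    by (rule mult_right_mono) (simp_all add: kummer_rate_ge_1)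
  moreover have "norm (a + of_nat n) \<le> norm a + real n"
    by (metis norm_of_nat norm_triangle_ineq)
  ultimately have "norm (a + of_nat n) \<le> ?q * (\<epsilon> + real n)"
    using assms(3) by (simp add: distrib_left)
  also have "\<epsilon> + real n \<le> norm (b + of_nat n)"
    using complex_Re_le_cmod[of "b + of_nat n"] assms(2) by simp
  then have "?q * (\<epsilon> + real n) \<le> ?q * norm (b + of_nat n)"
    using kummer_rate_ge_1[of \<epsilon> R] by (intro mult_left_mono) simp_all
  finally have "norm (a + of_nat n) \<le> ?q * norm (b + of_nat n)" .
  then have "norm (pochhammer a n) * norm (a + of_nat n)
      \<le> (?q ^ n * norm (pochhammer b n)) * (?q * norm (b + of_nat n))"
    using Suc.IH kummer_rate_ge_1[of \<epsilon> R] by (intro mult_mono) simp_all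
  then show ?case
    by (simp add: pochhammer_Suc norm_mult mult_ac)
qed simp

lemma norm_kummer_coeff_le:
  assumes "\<epsilon> > 0" "\<epsilon> \<le> Re b" "norm a \<le> R"
  shows "norm (kummer_coeff a b n) \<le> kummer_rate \<epsilon> R ^ n / fact n"
proof -
  have "norm (pochhammer b n) > 0"
    using assms by (simp add: pochhammer_nonzero)
  then have "norm (pochhammer a n) / norm (pochhammer b n) \<le> kummer_rate \<epsilon> R ^ n"
    using norm_pochhammer_le[OF assms, of n] by (simp add: pos_divide_le_eq)
  then have "norm (pochhammer a n) / norm (pochhammer b n) / fact n \<le> kummer_rate \<epsilon> R ^ n / fact n"
    by (rule divide_right_mono) simp
  then show ?thesis
    by (simp add: kummer_coeff_def norm_divide norm_mult)
qed

lemma norm_kummer_term_le: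
  assumes "\<epsilon> > 0" "\<epsilon> \<le> Re b" "norm a \<le> R" "norm x \<le> r"
  shows "norm (kummer_coeff a b n * x ^ n) \<le> (kummer_rate \<epsilon> R * r) ^ n /\<^sub>R fact n"
proof -
  have "norm (kummer_coeff a b n) * norm x ^ n \<le> (kummer_rate \<epsilon> R ^ n / fact n) * r ^ n"
    using assms kummer_rate_ge_1[of \<epsilon> R]
    by (intro mult_mono norm_kummer_coeff_le power_mono divide_nonneg_nonneg) simp_all
  then show ?thesis
    by (simp add: norm_mult norm_power power_mult_distrib divide_inverse mult_ac)
qed

lemma norm_kummer_diffs_term_le:
  assumes "\<epsilon> > 0" "\<epsilon> \<le> Re b" "norm a \<le> R" "norm x \<le> r"
  shows "norm (diffs (kummer_coeff a b) n * x ^ n) \<le> kummer_rate \<epsilon> R * ((kummer_rate \<epsilon> R * r) ^ n /\<^sub>R fact n)"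
proof -
  have "norm (diffs (kummer_coeff a b) n) = real (Suc n) * norm (kummer_coeff a b (Suc n))"
    unfolding diffs_def norm_mult by (simp only: norm_of_nat)
  also have "\<dots> \<le> real (Suc n) * (kummer_rate \<epsilon> R ^ Suc n / fact (Suc n))"
    by (intro mult_left_mono norm_kummer_coeff_le assms) simp
  also have "\<dots> = kummer_rate \<epsilon> R * (kummer_rate \<epsilon> R ^ n / fact n)"
    by (simp add: field_simps del: of_nat_Suc)
  finally have "norm (diffs (kummer_coeff a b) n) * norm x ^ n
      \<le> (kummer_rate \<epsilon> R * (kummer_rate \<epsilon> R ^ n / fact n)) * r ^ n"
    using assms kummer_rate_ge_1[of \<epsilon> R] by (intro mult_mono power_mono) simp_all
  then show ?thesis
    by (simp add: norm_mult norm_power power_mult_distrib divide_inverse mult_ac)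
qed

lemma summable_kummer:
  assumes "Re b > 0"
  shows "summable (\<lambda>n. kummer_coeff a b n * x ^ n)"
  by (rule summable_comparison_test'[OF summable_exp_generic, of 0])
    (rule norm_kummer_term_le[OF assms order_refl order_refl order_refl])

lemma norm_kummer_le:
  assumes "\<epsilon> > 0" "\<epsilon> \<le> Re b" "norm a \<le> R" "norm x \<le> r"
  shows "norm (kummer a b x) \<le> exp (kummer_rate \<epsilon> R * r)"
  unfolding kummer_def exp_def
  by (rule norm_suminf_le[OF norm_kummer_term_le[OF assms] summable_exp_generic])

definition kummer_deriv :: "complex \<Rightarrow> complex \<Rightarrow> complex \<Rightarrow> complex" where
  "kummer_deriv a b x = (\<Sum>n. diffs (kummer_coeff a b) n * x ^ n)"

definition kummer_deriv2 :: "complex \<Rightarrow> complex \<Rightarrow> complex \<Rightarrow> complex" where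
  "kummer_deriv2 a b x = (\<Sum>n. diffs (diffs (kummer_coeff a b)) n * x ^ n)"

lemma norm_kummer_deriv_le:
  assumes "\<epsilon> > 0" "\<epsilon> \<le> Re b" "norm a \<le> R" "norm x \<le> r"
  shows "norm (kummer_deriv a b x) \<le> kummer_rate \<epsilon> R * exp (kummer_rate \<epsilon> R * r)"
proof -
  have "summable (\<lambda>n. (kummer_rate \<epsilon> R * r) ^ n /\<^sub>R fact n)"
    by (rule summable_exp_generic)
  then show ?thesis
    unfolding kummer_deriv_def exp_def
    by (subst suminf_mult[symmetric], assumption)
      (rule norm_suminf_le[OF norm_kummer_diffs_term_le[OF assms] summable_mult])
qed

lemma has_field_derivative_kummer:
  assumes "Re b > 0"
  shows "(kummer a b has_field_derivative kummer_deriv a b x) (at x)"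
  unfolding kummer_def kummer_deriv_def
  by (rule termdiffs_strong_converges_everywhere[OF summable_kummer[OF assms]])

lemma summable_kummer_diffs:
  assumes "Re b > 0"
  shows "summable (\<lambda>n. diffs (kummer_coeff a b) n * x ^ n)"
  by (rule termdiff_converges_all[OF summable_kummer[OF assms]])

lemma has_field_derivative_kummer_deriv:
  assumes "Re b > 0"
  shows "(kummer_deriv a b has_field_derivative kummer_deriv2 a b x) (at x)"
  unfolding kummer_deriv_def kummer_deriv2_def
  by (rule termdiffs_strong_converges_everywhere[OF summable_kummer_diffs[OF assms]])

section \<open>Kummer's differential equation and the decay of its energy\<close>

lemma euler_operator_sums:
  fixes c :: "nat \<Rightarrow> complex"
  assumes "summable (\<lambda>n. diffs c n * x ^ n)"
  shows "(\<lambda>n. of_nat n * c n * x ^ n) sums (x * (\<Sum>n. diffs c n * x ^ n))"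
proof -
  have "(\<lambda>n. x * (of_nat n * c n * x ^ (n - Suc 0))) sums (x * (\<Sum>n. diffs c n * x ^ n))"
    by (rule sums_mult[OF diffs_equiv[OF assms]])
  moreover have "x * (of_nat n * c n * x ^ (n - Suc 0)) = of_nat n * c n * x ^ n" for n
    by (cases n) simp_all
  ultimately show ?thesis
    by simp
qed

text \<open>Multiplying a derivative by \<open>x\<close> weights the coefficient of
  \<open>x ^ n\<close> by \<open>n\<close>, so all summands become series in the same powers and the
  equation reduces to \<open>rec\<close>, the ratio of consecutive coefficients.\<close>

lemma kummer_ode:
  assumes "Re b > 0"
  shows "x * kummer_deriv2 a b x + (b - x) * kummer_deriv a b x - a * kummer a b x = 0"
proof -
  let ?c = "kummer_coeff a b"
  have s1: "(\<lambda>n. of_nat n * ?c n * x ^ n) sums (x * kummer_deriv a b x)"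
    unfolding kummer_deriv_def by (rule euler_operator_sums[OF summable_kummer_diffs[OF assms]])
  have s2: "(\<lambda>n. of_nat n * diffs ?c n * x ^ n) sums (x * kummer_deriv2 a b x)"
    unfolding kummer_deriv2_def
    by (rule euler_operator_sums[OF termdiff_converges_all[OF summable_kummer_diffs[OF assms]]])
  have s3: "(\<lambda>n. b * (diffs ?c n * x ^ n)) sums (b * kummer_deriv a b x)"
    unfolding kummer_deriv_def by (rule sums_mult[OF summable_sums[OF summable_kummer_diffs[OF assms]]])
  have s4: "(\<lambda>n. a * (?c n * x ^ n)) sums (a * kummer a b x)"
    unfolding kummer_def by (rule sums_mult[OF summable_sums[OF summable_kummer[OF assms]]])
  have rec: "diffs ?c n * (b + of_nat n) = (a + of_nat n) * ?c n" for n
  proof -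
    have "diffs ?c n = of_nat (Suc n) * (pochhammer a n * (a + of_nat n)
        / (pochhammer b n * (b + of_nat n) * (of_nat (Suc n) * fact n)))"
      by (simp only: diffs_def kummer_coeff_def pochhammer_Suc fact_Suc)
    moreover have "k * (p * z / (p' * z' * (k * f))) * z' = z * (p / (p' * f))"
      if "k \<noteq> 0" "z' \<noteq> 0" for k p p' z z' f :: complex
      using that by simp
    ultimately show ?thesis
      using add_of_nat_nonzero[OF assms, of n] by (simp add: kummer_coeff_def del: of_nat_Suc)
  qed
  have "of_nat n * diffs ?c n * x ^ n + b * (diffs ?c n * x ^ n) - of_nat n * ?c n * x ^ n - a * (?c n * x ^ n)
      = (diffs ?c n * (b + of_nat n) - (a + of_nat n) * ?c n) * x ^ n" for n
    by (simp add: algebra_simps)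
  then have "of_nat n * diffs ?c n * x ^ n + b * (diffs ?c n * x ^ n) - of_nat n * ?c n * x ^ n - a * (?c n * x ^ n) = 0" for n
    by (simp add: rec)
  then have "(\<lambda>n. 0) sums (x * kummer_deriv2 a b x + b * kummer_deriv a b x - x * kummer_deriv a b x - a * kummer a b x)"
    using sums_diff[OF sums_diff[OF sums_add[OF s2 s3] s1] s4] by simp
  then have "0 = x * kummer_deriv2 a b x + b * kummer_deriv a b x - x * kummer_deriv a b x - a * kummer a b x"
    using sums_unique2 sums_zero by blast
  then show ?thesis
    by (simp add: left_diff_distrib add_diff_eq)
qed

text \<open>The left side is half the derivative of the energy, for \<open>c = (a - b) / y\<close>,
  \<open>d = a * y\<close> (which also takes the place of the coefficient of \<open>h\<close> in the
  second equation) and \<open>e = a - b\<close>. After multiplication by \<open>s\<close> the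
  damping of \<open>u\<close> is at least \<open>s * \<epsilon>\<close> while the coupling stays
  below \<open>M\<close>. The share \<open>M^2 / (4 * \<epsilon>)\<close> of the damping completes
  the square \<open>- \<epsilon> * (norm h - M / (2 * \<epsilon>) * norm u)^2\<close>, and the share
  \<open>N\<close> absorbs the term with \<open>e\<close>.\<close>

lemma kummer_energy_dissipation:
  fixes h u a y c d e :: complex
  assumes eps: "\<epsilon> > 0" "\<epsilon> \<le> Re a" "\<epsilon> \<le> Re y"
    and M: "norm c + norm d \<le> M" "norm e \<le> N" and s: "s > 0" "M\<^sup>2 / (4 * \<epsilon>) + N \<le> s * \<epsilon>"
  shows "h \<bullet> ((- (a * h) + c * u) /\<^sub>R s) + u \<bullet> (- (y * u) + (- (d * h) + e * u) /\<^sub>R s) \<le> 0"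
proof -
  let ?E = "h \<bullet> ((- (a * h) + c * u) /\<^sub>R s) + u \<bullet> (- (y * u) + (- (d * h) + e * u) /\<^sub>R s)"
  have inner_mult: "v \<bullet> (w * v) = Re w * (norm v)\<^sup>2" for v w :: complex
    by (simp add: inner_complex_def cmod_power2) (simp add: power2_eq_square algebra_simps)
  have inner_le: "v \<bullet> (w * v') \<le> norm w * (norm v * norm v')" for v w v' :: complex
    using norm_cauchy_schwarz[of v "w * v'"] by (simp add: norm_mult mult_ac)
  have cancel: "s * (inverse s * t) = t" for t
    using s(1) by simp
  have "s * ?E = - (h \<bullet> (a * h)) + h \<bullet> (c * u) - s * (u \<bullet> (y * u)) + u \<bullet> (- d * h) + u \<bullet> (e * u)"
    by (simp add: inner_add_right inner_diff_right distrib_left right_diff_distrib cancel)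
  also have "\<dots> \<le> - (\<epsilon> * (norm h)\<^sup>2) + norm c * (norm h * norm u) - s * (\<epsilon> * (norm u)\<^sup>2)
      + norm d * (norm u * norm h) + N * (norm u)\<^sup>2"
  proof (intro add_mono diff_mono)
    show "- (h \<bullet> (a * h)) \<le> - (\<epsilon> * (norm h)\<^sup>2)"
      unfolding inner_mult using eps(2) by (simp add: mult_right_mono)
    show "s * (\<epsilon> * (norm u)\<^sup>2) \<le> s * (u \<bullet> (y * u))"
      unfolding inner_mult using eps(3) s(1) by (simp add: mult_right_mono)
    show "u \<bullet> (e * u) \<le> N * (norm u)\<^sup>2"
      unfolding inner_mult using M(2) complex_Re_le_cmod[of e] by (intro mult_right_mono) auto
    show "h \<bullet> (c * u) \<le> norm c * (norm h * norm u)"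
      by (rule inner_le)
    show "u \<bullet> (- d * h) \<le> norm d * (norm u * norm h)"
      using inner_le[of u "- d" h] by simp
  qed
  also have "\<dots> = - (\<epsilon> * (norm h)\<^sup>2) + (norm c + norm d) * (norm h * norm u) + (N - s * \<epsilon>) * (norm u)\<^sup>2"
    by (simp add: algebra_simps)
  also have "\<dots> \<le> - (\<epsilon> * (norm h)\<^sup>2) + M * (norm h * norm u) + (- (M\<^sup>2 / (4 * \<epsilon>))) * (norm u)\<^sup>2"
    using M(1) s(2) by (intro add_mono mult_right_mono order_refl) auto
  also have "\<dots> = - \<epsilon> * (norm h - M / (2 * \<epsilon>) * norm u)\<^sup>2"
    using eps(1) by (simp add: power2_diff power_mult_distrib power_divide field_simps power2_eq_square)
  also have "\<dots> \<le> 0"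
    using eps(1) by (simp add: mult_nonpos_nonneg)
  finally show ?thesis
    using s(1) by (simp add: mult_le_0_iff)
qed

lemma has_real_derivative_inner_self:
  fixes f :: "real \<Rightarrow> complex"
  assumes "(f has_vector_derivative f') (at s)"
  shows "((\<lambda>s. f s \<bullet> f s) has_real_derivative 2 * (f s \<bullet> f')) (at s)"
proof -
  have "((\<lambda>s. f s \<bullet> f s) has_derivative (\<lambda>t. f s \<bullet> (t *\<^sub>R f') + (t *\<^sub>R f') \<bullet> f s)) (at s)"
    using assms unfolding has_vector_derivative_def by (intro has_derivative_inner)
  moreover have "(\<lambda>t. f s \<bullet> (t *\<^sub>R f') + (t *\<^sub>R f') \<bullet> f s) = (*) (2 * (f s \<bullet> f'))"
    by (rule ext) (simp add: inner_commute)
  ultimately show ?thesis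
    by (simp add: has_field_derivative_def)
qed

text \<open>
  Along the ray \<open>g s = kummer a b (- s y)\<close> put \<open>u = g'\<close> and \<open>h = g + u / y\<close>.  The differential equation
  turns into a linear system for \<open>(h, u)\<close> whose energy \<open>|h|\<^sup>2 + |u|\<^sup>2\<close> decreases for large \<open>s\<close>.
\<close>

lemma kummer_bounded_on_rays:
  assumes eps: "\<epsilon> > 0"
  shows "\<exists>C. \<forall>a b y s. \<epsilon> \<le> Re a \<and> norm a \<le> R \<and> \<epsilon> \<le> Re b \<and> norm b \<le> R \<and> \<epsilon> \<le> Re y \<and> norm y \<le> R \<and> 0 \<le> s
    \<longrightarrow> norm (kummer a b (- (of_real s * y))) \<le> C"
proof (cases "R > 0")
  \<comment> \<open>The hypotheses contradict each other here, since
    \<open>\<epsilon> \<le> Re a \<le> norm a \<le> R\<close>; any constant will do.\<close>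
  case False
  then show ?thesis
  proof (intro exI[of _ 0] allI impI)
    fix a b y :: complex and s :: real
    assume "\<epsilon> \<le> Re a \<and> norm a \<le> R \<and> \<epsilon> \<le> Re b \<and> norm b \<le> R \<and> \<epsilon> \<le> Re y \<and> norm y \<le> R \<and> 0 \<le> s"
    then show "norm (kummer a b (- (of_real s * y))) \<le> 0"
      using False eps complex_Re_le_cmod[of a] by linarith
  qed
next
  case R: True
  \<comment> \<open>\<open>M\<close> and \<open>N\<close> bound the coefficients of the linear
    system, and \<open>s0\<close> is the point from which the dissipation estimate applies. Up to
    \<open>s0\<close> the power series gives the bound \<open>E\<close> for the function and
    \<open>q * E\<close> for its derivative; \<open>W\<close> bounds the energy at
    \<open>s0\<close>, where the decay starts.\<close>
  define M where "M = 2 * R / \<epsilon> + R * R"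
  define N where "N = 2 * R"
  define s0 where "s0 = (M\<^sup>2 / (4 * \<epsilon>) + N) / \<epsilon>"
  define q where "q = kummer_rate \<epsilon> R"
  define E where "E = exp (q * (s0 * R))"
  define W where "W = (E + R * (q * E) / \<epsilon>)\<^sup>2 + (R * (q * E))\<^sup>2"
  have s0: "s0 > 0"
    using eps R by (simp add: s0_def N_def add_nonneg_pos)
  have "norm (kummer a b (- (of_real s * y))) \<le> E + (sqrt W + sqrt W / \<epsilon>)"
    if a: "\<epsilon> \<le> Re a" "norm a \<le> R" and b: "\<epsilon> \<le> Re b" "norm b \<le> R" and y: "\<epsilon> \<le> Re y" "norm y \<le> R" and s: "0 \<le> s"
    for a b y s
  proof (cases "s \<le> s0")
    case True
    have "norm (- (of_real s * y)) \<le> s0 * R"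
      using True s y(2) by (simp add: norm_mult mult_mono)
    then have "norm (kummer a b (- (of_real s * y))) \<le> E"
      unfolding E_def q_def by (rule norm_kummer_le[OF eps b(1) a(2)])
    moreover have "sqrt W \<ge> 0" "sqrt W / \<epsilon> \<ge> 0"
      using eps by (simp_all add: W_def)
    ultimately show ?thesis
      by linarith
  next
    case False
    have pos: "Re b > 0" "y \<noteq> 0"
      using eps b(1) y(1) by auto
    define g where "g = (\<lambda>s. kummer a b (- (of_real s * y)))"
    define u where "u = (\<lambda>s. - y * kummer_deriv a b (- (of_real s * y)))"
    \<comment> \<open>The correction \<open>u / y\<close> cancels the term of \<open>g' = u\<close>
      that carries no factor \<open>1 / s\<close>: the equation gives
      \<open>s * h' = - a * h + ((a - b) / y) * u\<close>, where \<open>Re a > 0\<close> damps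
      \<open>h\<close>.\<close>
    define h where "h = (\<lambda>s. g s + u s / y)"
    define V where "V = (\<lambda>s. h s \<bullet> h s + u s \<bullet> u s)"
    have ray: "((\<lambda>s. - (of_real s * y)) has_vector_derivative - y) (at s)" for s
      by (auto intro!: derivative_eq_intros)
    have dg: "(g has_vector_derivative u s) (at s)" for s
      using field_vector_diff_chain_at[OF ray has_field_derivative_kummer[OF pos(1), of a]]
      by (simp add: g_def u_def o_def)
    have "((\<lambda>s. kummer_deriv a b (- (of_real s * y))) has_vector_derivative - y * kummer_deriv2 a b (- (of_real s * y))) (at s)" for s
      using field_vector_diff_chain_at[OF ray has_field_derivative_kummer_deriv[OF pos(1), of a]]
      by (simp add: o_def)
    then have du: "(u has_vector_derivative y * y * kummer_deriv2 a b (- (of_real s * y))) (at s)" for s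
      unfolding u_def using has_vector_derivative_mult_right[of _ _ _ "- y"] by (force simp: mult.assoc)
    have ode: "of_real s * (y * y * kummer_deriv2 a b (- (of_real s * y)))
        = - (y * of_real s) * u s - (b * u s + a * y * g s)" for s
    proof -
      let ?x = "- (of_real s * y)"
      have "- y * (?x * kummer_deriv2 a b ?x + (b - ?x) * kummer_deriv a b ?x - a * kummer a b ?x) = 0"
        by (simp only: kummer_ode[OF pos(1)] mult_zero_right)
      then show ?thesis
        unfolding u_def g_def by (simp add: algebra_simps)
    qed
    have gh: "g s = h s - u s / y" for s
      by (simp add: h_def)
    have eqs: "y * y * kummer_deriv2 a b (- (of_real s * y)) = - (y * u s) + (- ((a * y) * h s) + (a - b) * u s) /\<^sub>R s"
      "u s + (y * y * kummer_deriv2 a b (- (of_real s * y))) / y = (- (a * h s) + ((a - b) / y) * u s) /\<^sub>R s"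
      if "s > 0" for s
    proof -
      have aux: "K = - (y * v) + (- ((a * y) * w) + (a - b) * v) /\<^sub>R s"
        if "of_real s * K = - (y * of_real s) * v - (b * v + a * y * (w - v / y))" for K v w
      proof -
        have "a * y * (w - v / y) = a * y * w - a * v"
          using pos(2) by (simp add: right_diff_distrib)
        with that have "of_real s * K = - (y * of_real s) * v - (b * v + (a * y * w - a * v))"
          by simp
        with \<open>s > 0\<close> show ?thesis
          by (simp add: scaleR_conv_of_real field_simps)
      qed
      show 1: "y * y * kummer_deriv2 a b (- (of_real s * y)) = - (y * u s) + (- ((a * y) * h s) + (a - b) * u s) /\<^sub>R s"
        by (rule aux) (use ode[of s] in \<open>simp only: gh\<close>)
      show "u s + (y * y * kummer_deriv2 a b (- (of_real s * y))) / y = (- (a * h s) + ((a - b) / y) * u s) /\<^sub>R s"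
        unfolding 1 using that pos(2) by (simp add: scaleR_conv_of_real field_simps)
    qed
    have dh: "(h has_vector_derivative u s + (y * y * kummer_deriv2 a b (- (of_real s * y))) / y) (at s)" for s
      unfolding h_def by (intro has_vector_derivative_add has_vector_derivative_divide dg du)
    have "V s \<le> V s0"
    proof (rule DERIV_nonpos_imp_nonincreasing[of s0 s V])
      show "s0 \<le> s"
        using False by simp
      fix t assume t: "s0 \<le> t" "t \<le> s"
      with s0 have tpos: "t > 0"
        by simp
      have "(V has_real_derivative 2 * (h t \<bullet> (u t + (y * y * kummer_deriv2 a b (- (of_real t * y))) / y))
          + 2 * (u t \<bullet> (y * y * kummer_deriv2 a b (- (of_real t * y))))) (at t)"
        unfolding V_def by (intro DERIV_add has_real_derivative_inner_self dh du)
      moreover have "h t \<bullet> (u t + (y * y * kummer_deriv2 a b (- (of_real t * y))) / y)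
          + u t \<bullet> (y * y * kummer_deriv2 a b (- (of_real t * y))) \<le> 0"
        unfolding eqs(2)[OF tpos] unfolding eqs(1)[OF tpos]
      proof (rule kummer_energy_dissipation[OF eps a(1) y(1) _ _ tpos])
        have ab: "norm (a - b) \<le> 2 * R"
          using norm_triangle_ineq4[of a b] a b by simp
        then show "norm (a - b) \<le> N"
          by (simp add: N_def)
        have "\<epsilon> \<le> norm y"
          using complex_Re_le_cmod[of y] y(1) by simp
        then have "norm ((a - b) / y) \<le> 2 * R / \<epsilon>"
          unfolding norm_divide using ab eps R by (intro frac_le) simp_all
        moreover have "norm (a * y) \<le> R * R"
          unfolding norm_mult using a y R by (intro mult_mono) simp_all
        ultimately show "norm ((a - b) / y) + norm (a * y) \<le> M"
          by (simp add: M_def)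
        have "s0 * \<epsilon> \<le> t * \<epsilon>"
          using t eps by simp
        then show "M\<^sup>2 / (4 * \<epsilon>) + N \<le> t * \<epsilon>"
          using eps by (simp add: s0_def)
      qed
      ultimately show "\<exists>z. (V has_real_derivative z) (at t) \<and> z \<le> 0"
        by (intro exI conjI) (assumption, simp)
    qed
    also have "V s0 \<le> W"
    proof -
      have x: "norm (- (of_real s0 * y)) \<le> s0 * R"
        using s0 y(2) by (simp add: norm_mult)
      have "norm (kummer_deriv a b (- (of_real s0 * y))) \<le> q * E"
        unfolding E_def q_def by (rule norm_kummer_deriv_le[OF eps b(1) a(2) x])
      then have us: "norm (u s0) \<le> R * (q * E)"
        using y(2) R by (simp add: u_def norm_mult mult_mono)
      have gs: "norm (g s0) \<le> E"
        unfolding E_def q_def g_def by (rule norm_kummer_le[OF eps b(1) a(2) x])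
      have "norm (u s0) / norm y \<le> R * (q * E) / \<epsilon>"
        using us y(1) eps complex_Re_le_cmod[of y] order_trans[OF norm_ge_zero us]
        by (intro frac_le) simp_all
      then have "norm (h s0) \<le> E + R * (q * E) / \<epsilon>"
        using gs norm_triangle_ineq[of "g s0" "u s0 / y"] by (simp add: h_def norm_divide)
      then show ?thesis
        using us by (simp add: V_def W_def dot_square_norm add_mono power_mono)
    qed
    finally have VW: "(norm (h s))\<^sup>2 + (norm (u s))\<^sup>2 \<le> W"
      by (simp add: V_def dot_square_norm)
    have "(norm (h s))\<^sup>2 \<le> W" "(norm (u s))\<^sup>2 \<le> W"
      using VW zero_le_power2[of "norm (h s)"] zero_le_power2[of "norm (u s)"] by linarith+
    then have "norm (h s) \<le> sqrt W" "norm (u s) \<le> sqrt W"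
      by (simp_all add: real_le_rsqrt)
    moreover have "norm (u s / y) \<le> sqrt W / \<epsilon>"
      unfolding norm_divide using calculation(2) y(1) eps complex_Re_le_cmod[of y]
        order_trans[OF norm_ge_zero calculation(2)] by (intro frac_le) simp_all
    ultimately have "norm (g s) \<le> sqrt W + sqrt W / \<epsilon>"
      unfolding gh using norm_triangle_ineq4[of "h s" "u s / y"] by simp
    moreover have "E \<ge> 0"
      by (simp add: E_def)
    ultimately show ?thesis
      by (simp add: g_def)
  qed
  then show ?thesis
    by (intro exI[of _ "E + (sqrt W + sqrt W / \<epsilon>)"] allI impI) (elim conjE)
qed

subsection \<open>Boundedness of the matrix confluent hypergeometric function\<close>

text \<open>For square matrices a left inverse is two-sided, hence unique, so the choice in
  \<open>matrix_inv\<close> is forced.\<close>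

lemma matrix_inv_eqI:
  fixes A X :: "complex^'n^'n"
  assumes "X ** A = mat 1"
  shows "matrix_inv A = X"
proof -
  have r: "A ** X = mat 1"
    by (rule matrix_left_right_inverse1[OF assms])
  have "A ** matrix_inv A = mat 1 \<and> matrix_inv A ** A = mat 1"
    unfolding matrix_inv_def by (rule someI[of _ X]) (simp add: r assms)
  then show ?thesis
    by (metis assms matrix_mul_assoc matrix_mul_lid matrix_mul_rid)
qed

text \<open>The majorant alone controls the remainder, hence uniformly in any parameters hidden in
  \<open>f\<close>. The continuity of the calculus and the passage from the Kummer function to its
  partial sums both rest on this.\<close>

lemma suminf_tail_bound:
  fixes f :: "nat \<Rightarrow> 'a :: banach"
  assumes "\<And>n. norm (f n) \<le> c n" "summable c"
  shows "norm (suminf f - (\<Sum>n<N. f n)) \<le> suminf c - (\<Sum>n<N. c n)"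
proof -
  have "summable f"
    using assms by (rule summable_comparison_test'[of c 0, rotated])
  then have "suminf f - (\<Sum>n<N. f n) = (\<Sum>n. f (n + N))"
    by (simp add: suminf_minus_initial_segment)
  also have "norm \<dots> \<le> (\<Sum>n. c (n + N))"
    by (rule norm_suminf_le) (simp_all add: assms summable_ignore_initial_segment)
  also have "\<dots> = suminf c - (\<Sum>n<N. c n)"
    by (rule suminf_minus_initial_segment[OF assms(2)])
  finally show ?thesis .
qed

lemma tail_tendsto_zero:
  fixes c :: "nat \<Rightarrow> real"
  assumes "summable c"
  shows "(\<lambda>N. suminf c - (\<Sum>n<N. c n)) \<longlonglongrightarrow> 0"
  using tendsto_diff[OF tendsto_const summable_LIMSEQ[OF assms], of "suminf c"] by simp

lemma norm_matrix_le_sum: "norm (X :: complex^'n^'m) \<le> (\<Sum>i\<in>UNIV. \<Sum>j\<in>UNIV. norm (X $ i $ j))"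
proof -
  have "norm X \<le> (\<Sum>i\<in>UNIV. norm (X $ i))"
    unfolding norm_vec_def by (rule L2_set_le_sum) simp
  also have "\<dots> \<le> (\<Sum>i\<in>UNIV. \<Sum>j\<in>UNIV. norm (X $ i $ j))"
    by (rule sum_mono, subst norm_vec_def, rule L2_set_le_sum) simp
  finally show ?thesis .
qed

lemma norm_entry_le: "norm (X $ i $ j) \<le> norm (X :: complex^'n^'m)"
  using Finite_Cartesian_Product.norm_nth_le[of "X $ i" j] Finite_Cartesian_Product.norm_nth_le[of X i]
  by linarith

lemma compact_right_half_plane_bounds:
  assumes "compact D" "D \<subseteq> right_half_plane"
  obtains \<epsilon> R where "\<epsilon> > 0" "\<And>x. x \<in> D \<Longrightarrow> \<epsilon> \<le> Re x" "\<And>x. x \<in> D \<Longrightarrow> norm x \<le> R"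
proof -
  obtain R where R: "\<And>x. x \<in> D \<Longrightarrow> norm x \<le> R"
    using compact_imp_bounded[OF assms(1)] unfolding bounded_iff by blast
  show ?thesis
  proof (cases "D = {}")
    case True
    then show ?thesis
      by (intro that[of 1 0]) simp_all
  next
    case False
    obtain x where x: "x \<in> D" "\<forall>y\<in>D. Re x \<le> Re y"
      using continuous_attains_inf[OF assms(1) False continuous_on_Re[OF continuous_on_id]] by blast
    show ?thesis
      by (rule that[of "Re x" R]) (use x assms(2) R in blast)+
  qed
qed

context holomorphic_calculus
begin

section \<open>Images of products, inverses and series under the calculus\<close>

lemma calc_sum:
  assumes "finite I" "\<And>n. n \<in> I \<Longrightarrow> f n holomorphic_on right_half_plane"
  shows "\<Phi> (\<lambda>x. \<Sum>n\<in>I. f n x) = (\<Sum>n\<in>I. \<Phi> (f n))"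
  using assms
proof (induction I rule: finite_induct)
  case empty
  then show ?case
    by (simp add: calc_const)
next
  case (insert k I)
  have "\<Phi> (\<lambda>x. f k x + (\<Sum>n\<in>I. f n x)) = \<Phi> (f k) + \<Phi> (\<lambda>x. \<Sum>n\<in>I. f n x)"
    by (rule calc_add) (use insert.prems in \<open>auto intro!: holomorphic_intros\<close>)
  with insert show ?case
    by simp
qed

lemma calc_diff:
  assumes "f holomorphic_on right_half_plane" "g holomorphic_on right_half_plane"
  shows "\<Phi> (\<lambda>x. f x - g x) = \<Phi> f - \<Phi> g"
proof -
  have "\<Phi> (\<lambda>x. f x + (- 1) * g x) = \<Phi> f + mat_scale (- 1) (\<Phi> g)"
    unfolding calc_cmult[OF assms(2), symmetric]
    by (rule calc_add) (intro holomorphic_intros assms)+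
  then show ?thesis
    by (simp add: ms.minus_left)
qed

text \<open>The case \<open>C = 0\<close> of \<open>calc_bound\<close>, applied to the
  difference.\<close>

lemma calc_cong:
  assumes "f holomorphic_on right_half_plane" "g holomorphic_on right_half_plane"
    and "\<And>x. x \<in> D \<Longrightarrow> f x = g x"
  shows "\<Phi> f = \<Phi> g"
proof -
  have "norm (\<Phi> (\<lambda>x. f x - g x)) \<le> K * 0"
    by (rule calc_bound) (use assms in \<open>auto intro!: holomorphic_intros\<close>)
  then show ?thesis
    by (simp add: calc_diff assms(1,2))
qed

lemma calc_mult_shift:
  assumes "f holomorphic_on right_half_plane"
  shows "\<Phi> (\<lambda>x. f x * (x + c)) = \<Phi> f ** (M + mat c)"
proof -
  have "\<Phi> (\<lambda>x. f x * x + c * f x) = \<Phi> f ** M + mat_scale c (\<Phi> f)"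
    using assms by (subst calc_add) (auto intro!: holomorphic_intros simp: calc_mult_ident calc_cmult)
  moreover have "mat_scale c (\<Phi> f) = \<Phi> f ** mat c"
    unfolding mat_eq_mat_scale[of c] by simp
  ultimately show ?thesis
    by (simp add: mm.add_right algebra_simps)
qed

lemma holomorphic_pochhammer: "(\<lambda>x. pochhammer x n) holomorphic_on S"
  by (induction n) (auto simp: pochhammer_Suc intro!: holomorphic_intros)

lemma calc_mult_pochhammer:
  assumes "f holomorphic_on right_half_plane"
  shows "\<Phi> (\<lambda>x. f x * pochhammer x n) = \<Phi> f ** mat_poch M n"
proof (induction n)
  case (Suc n)
  have "\<Phi> (\<lambda>x. (f x * pochhammer x n) * (x + of_nat n)) = \<Phi> (\<lambda>x. f x * pochhammer x n) ** (M + mat (of_nat n))"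
    by (rule calc_mult_shift) (intro holomorphic_intros assms holomorphic_pochhammer)
  then show ?case
    by (simp add: Suc pochhammer_Suc mult.assoc matrix_mul_assoc)
qed simp

lemma calc_pochhammer: "\<Phi> (\<lambda>x. pochhammer x n) = mat_poch M n"
  using calc_mult_pochhammer[of "\<lambda>x. 1" n] by (simp add: calc_const)

text \<open>The zeros of the Pochhammer polynomial are among \<open>0, -1, -2, ...\<close>, outside
  the open right half plane, so the calculus accepts its reciprocal. Multiplying the image by
  \<open>mat_poch M n\<close> yields the image of the constant \<open>1\<close>, which makes it a
  left inverse.\<close>

lemma calc_inverse_pochhammer: "\<Phi> (\<lambda>x. 1 / pochhammer x n) = matrix_inv (mat_poch M n)"
proof (rule matrix_inv_eqI[symmetric])
  have h: "(\<lambda>x. 1 / pochhammer x n) holomorphic_on right_half_plane"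
    by (intro holomorphic_intros holomorphic_pochhammer) (simp add: pochhammer_nonzero)
  have "\<Phi> (\<lambda>x. 1 / pochhammer x n) ** mat_poch M n = \<Phi> (\<lambda>x. 1 / pochhammer x n * pochhammer x n)"
    by (rule calc_mult_pochhammer[OF h, symmetric])
  also have "\<dots> = \<Phi> (\<lambda>x. 1)"
  proof (rule calc_cong)
    show "(\<lambda>x. 1 / pochhammer x n * pochhammer x n) holomorphic_on right_half_plane"
      by (intro holomorphic_on_mult h holomorphic_pochhammer)
  qed (use D_subset in \<open>auto simp: pochhammer_nonzero\<close>)
  finally show "\<Phi> (\<lambda>x. 1 / pochhammer x n) ** mat_poch M n = mat 1"
    by (simp add: calc_const)
qed

lemma calc_mult_power_shift:
  assumes "f holomorphic_on right_half_plane"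
  shows "\<Phi> (\<lambda>x. f x * (x + c) ^ n) = \<Phi> f ** mat_pow (M + mat c) n"
proof (induction n)
  case (Suc n)
  have "\<Phi> (\<lambda>x. (f x * (x + c) ^ n) * (x + c)) = \<Phi> (\<lambda>x. f x * (x + c) ^ n) ** (M + mat c)"
    by (rule calc_mult_shift) (intro holomorphic_intros assms)
  then show ?case
    by (simp add: Suc mult.assoc matrix_mul_assoc mult.commute[of "_ + c"])
qed simp

lemma calc_power_shift: "\<Phi> (\<lambda>x. (x + c) ^ n) = mat_pow (M + mat c) n"
  using calc_mult_power_shift[of "\<lambda>x. 1" c n] by (simp add: calc_const)

lemma calc_power: "\<Phi> (\<lambda>x. x ^ n) = mat_pow M n"
  using calc_power_shift[of 0 n] by simp

text \<open>Continuity of \<open>\<Phi>\<close> under uniform convergence on \<open>D\<close>, with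
  the uniformity supplied by the majorant \<open>c\<close>.\<close>

lemma calc_sums:
  assumes f: "\<And>n. f n holomorphic_on right_half_plane" and F: "F holomorphic_on right_half_plane"
    and le: "\<And>n x. x \<in> D \<Longrightarrow> norm (f n x) \<le> c n" and c: "summable c"
    and sums: "\<And>x. x \<in> D \<Longrightarrow> (\<lambda>n. f n x) sums F x"
  shows "(\<lambda>n. \<Phi> (f n)) sums \<Phi> F"
  unfolding sums_def
proof (rule metric_LIMSEQ_I)
  fix e :: real assume "e > 0"
  have "(\<lambda>N. K * (suminf c - (\<Sum>n<N. c n))) \<longlonglongrightarrow> K * 0"
    by (intro tendsto_mult tendsto_const tail_tendsto_zero c)
  from LIMSEQ_D[OF this \<open>e > 0\<close>]
  obtain N0 where N0: "\<forall>N\<ge>N0. norm (K * (suminf c - (\<Sum>n<N. c n))) < e"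
    by auto
  show "\<exists>N0. \<forall>N\<ge>N0. dist (\<Sum>n<N. \<Phi> (f n)) (\<Phi> F) < e"
  proof (intro exI allI impI)
    fix N assume "N \<ge> N0"
    have hs: "(\<lambda>x. \<Sum>n<N. f n x) holomorphic_on right_half_plane"
      by (intro holomorphic_intros f)
    have "dist (\<Sum>n<N. \<Phi> (f n)) (\<Phi> F) = norm (\<Phi> (\<lambda>x. F x - (\<Sum>n<N. f n x)))"
      by (simp add: calc_diff[OF F hs] calc_sum f dist_norm norm_minus_commute)
    also have "\<dots> \<le> K * (suminf c - (\<Sum>n<N. c n))"
    proof (rule calc_bound)
      show "(\<lambda>x. F x - (\<Sum>n<N. f n x)) holomorphic_on right_half_plane"
        by (intro holomorphic_on_diff F hs)
      fix x assume x: "x \<in> D"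
      show "norm (F x - (\<Sum>n<N. f n x)) \<le> suminf c - (\<Sum>n<N. c n)"
        unfolding sums_unique[OF sums[OF x]] by (rule suminf_tail_bound[OF le[OF x] c])
    qed
    also have "\<dots> < e"
      using N0[rule_format, OF \<open>N \<ge> N0\<close>] by simp
    finally show "dist (\<Sum>n<N. \<Phi> (f n)) (\<Phi> F) < e" .
  qed
qed

text \<open>The matrices \<open>W n\<close> cannot be moved inside \<open>\<Phi>\<close>, but their
  entries can: an entry of the sum is a sum over \<open>k\<close> of entries of
  \<open>\<Phi>\<close> applied to the scalar functions
  \<open>\<Sum>n\<in>I. W n $ k $ j * p n x\<close>, and these are bounded by \<open>C\<close> on
  \<open>D\<close>. In \<open>L\<close> one factor \<open>CARD('n)\<close> counts \<open>k\<close>,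
  the other two count the positions \<open>i\<close> and \<open>j\<close>.\<close>

lemma calc_weighted_bound:
  defines "L \<equiv> real CARD('n) * (real CARD('n) * (real CARD('n) * K))"
  assumes I: "finite I" "\<And>n. n \<in> I \<Longrightarrow> p n holomorphic_on right_half_plane"
    and le: "\<And>x. x \<in> D \<Longrightarrow> norm (\<Sum>n\<in>I. mat_scale (p n x) (W n)) \<le> C"
  shows "norm (\<Sum>n\<in>I. \<Phi> (p n) ** W n) \<le> L * C"
proof -
  have "norm ((\<Sum>n\<in>I. \<Phi> (p n) ** W n) $ i $ j) \<le> real CARD('n) * (K * C)" for i j
  proof -
    have entry: "\<Phi> (\<lambda>x. \<Sum>n\<in>I. (W n $ k $ j) * p n x) $ i $ k = (\<Sum>n\<in>I. \<Phi> (p n) $ i $ k * W n $ k $ j)" for k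
    proof -
      have "\<Phi> (\<lambda>x. \<Sum>n\<in>I. (W n $ k $ j) * p n x) = (\<Sum>n\<in>I. \<Phi> (\<lambda>x. (W n $ k $ j) * p n x))"
        by (rule calc_sum[OF I(1)]) (intro holomorphic_intros I(2))
      also have "\<dots> = (\<Sum>n\<in>I. mat_scale (W n $ k $ j) (\<Phi> (p n)))"
        by (intro sum.cong refl calc_cmult I(2))
      finally show ?thesis
        by (simp add: mat_scale_nth mult.commute)
    qed
    have "(\<Sum>n\<in>I. \<Phi> (p n) ** W n) $ i $ j = (\<Sum>n\<in>I. \<Sum>k\<in>UNIV. \<Phi> (p n) $ i $ k * W n $ k $ j)"
      by (simp add: matrix_matrix_mult_def)
    also have "\<dots> = (\<Sum>k\<in>UNIV. \<Phi> (\<lambda>x. \<Sum>n\<in>I. (W n $ k $ j) * p n x) $ i $ k)"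
      unfolding entry by (rule sum.swap)
    also have "norm \<dots> \<le> (\<Sum>k\<in>(UNIV :: 'n set). K * C)"
    proof (rule sum_norm_le)
      fix k
      have "norm (\<Phi> (\<lambda>x. \<Sum>n\<in>I. (W n $ k $ j) * p n x)) \<le> K * C"
      proof (rule calc_bound)
        show "(\<lambda>x. \<Sum>n\<in>I. (W n $ k $ j) * p n x) holomorphic_on right_half_plane"
          by (intro holomorphic_intros I)
        fix x assume "x \<in> D"
        have "(\<Sum>n\<in>I. (W n $ k $ j) * p n x) = (\<Sum>n\<in>I. mat_scale (p n x) (W n)) $ k $ j"
          by (simp add: mat_scale_nth mult.commute)
        also have "norm \<dots> \<le> C"
          using norm_entry_le le[OF \<open>x \<in> D\<close>] by (rule order_trans)
        finally show "norm (\<Sum>n\<in>I. (W n $ k $ j) * p n x) \<le> C" .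
      qed
      then show "norm (\<Phi> (\<lambda>x. \<Sum>n\<in>I. (W n $ k $ j) * p n x) $ i $ k) \<le> K * C"
        by (rule order_trans[OF norm_entry_le])
    qed
    finally show ?thesis
      by simp
  qed
  then have "(\<Sum>i\<in>UNIV. \<Sum>j\<in>UNIV. norm ((\<Sum>n\<in>I. \<Phi> (p n) ** W n) $ i $ j))
      \<le> (\<Sum>i\<in>(UNIV :: 'n set). \<Sum>j\<in>(UNIV :: 'n set). real CARD('n) * (K * C))"
    by (intro sum_mono)
  then show ?thesis
    using norm_matrix_le_sum[of "\<Sum>n\<in>I. \<Phi> (p n) ** W n"] by (simp add: L_def mult.assoc)
qed

end

definition mat_1F1_term :: "complex^'n^'n \<Rightarrow> complex^'n^'n \<Rightarrow> complex^'n^'n \<Rightarrow> nat \<Rightarrow> complex^'n^'n" where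
  "mat_1F1_term A B W n = (mat_poch A n ** matrix_inv (mat_poch B n) ** mat_pow W n) /\<^sub>R fact n"

text \<open>
  Applying the calculus to \<open>A\<close>, \<open>B\<close> and \<open>Y\<close> one after the other bounds a partial sum of the matrix
  series by the corresponding scalar partial sums; no commutativity is involved.
\<close>

lemma norm_mat_1F1_partial_sum_le:
  fixes A B Y :: "complex^'n^'n"
  assumes "holomorphic_calculus A \<Phi>A DA KA" "holomorphic_calculus B \<Phi>B DB KB" "holomorphic_calculus Y \<Phi>Y DY KY"
  shows "\<exists>K\<ge>0. \<forall>I t C. finite I
    \<longrightarrow> (\<forall>a\<in>DA. \<forall>b\<in>DB. \<forall>y\<in>DY. norm (\<Sum>n\<in>I. kummer_coeff a b n * (t * y) ^ n) \<le> C)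
    \<longrightarrow> norm (\<Sum>n\<in>I. mat_1F1_term A B (mat_scale t Y) n) \<le> K * C"
proof -
  interpret A: holomorphic_calculus A \<Phi>A DA KA by (rule assms(1))
  interpret B: holomorphic_calculus B \<Phi>B DB KB by (rule assms(2))
  interpret Y: holomorphic_calculus Y \<Phi>Y DY KY by (rule assms(3))
  define LA where "LA = real CARD('n) * (real CARD('n) * (real CARD('n) * KA))"
  define LB where "LB = real CARD('n) * (real CARD('n) * (real CARD('n) * KB))"
  have "norm (\<Sum>n\<in>I. mat_1F1_term A B (mat_scale t Y) n) \<le> LA * (LB * (KY * C))"
    if I: "finite I" and C: "\<forall>a\<in>DA. \<forall>b\<in>DB. \<forall>y\<in>DY. norm (\<Sum>n\<in>I. kummer_coeff a b n * (t * y) ^ n) \<le> C" for I t C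
  proof -
    have trm: "mat_1F1_term A B (mat_scale t Y) n = \<Phi>A (\<lambda>x. pochhammer x n)
        ** mat_scale (t ^ n / fact n) (\<Phi>B (\<lambda>x. 1 / pochhammer x n) ** mat_pow Y n)" for n
      unfolding mat_1F1_term_def A.calc_pochhammer B.calc_inverse_pochhammer scaleR_eq_mat_scale mat_pow_scale
      by (simp add: matrix_mul_assoc divide_inverse mult.commute)
    \<comment> \<open>The rightmost matrix comes first: with scalars in place of \<open>A\<close>
      and \<open>B\<close> the sum is the image under \<open>\<Phi>Y\<close> of a scalar partial
      sum. Two uses of \<open>calc_weighted_bound\<close> then restore \<open>B\<close> and
      \<open>A\<close>, each at the price of a constant.\<close>
    have 1: "norm (\<Phi>Y (\<lambda>y. \<Sum>n\<in>I. kummer_coeff a b n * (t * y) ^ n)) \<le> KY * C" if "a \<in> DA" "b \<in> DB" for a b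
      using C that by (intro Y.calc_bound holomorphic_intros) simp_all
    have calcY: "\<Phi>Y (\<lambda>y. \<Sum>n\<in>I. kummer_coeff a b n * (t * y) ^ n)
        = (\<Sum>n\<in>I. mat_scale (1 / pochhammer b n) (mat_scale (pochhammer a n * (t ^ n / fact n)) (mat_pow Y n)))" for a b
    proof -
      have "\<Phi>Y (\<lambda>y. kummer_coeff a b n * (t * y) ^ n)
          = mat_scale (1 / pochhammer b n) (mat_scale (pochhammer a n * (t ^ n / fact n)) (mat_pow Y n))" for n
        using Y.calc_cmult[of "\<lambda>y. y ^ n" "kummer_coeff a b n * t ^ n"]
        by (simp add: Y.calc_power holomorphic_intros kummer_coeff_def power_mult_distrib mult_ac)
      then show ?thesis
        by (subst Y.calc_sum[OF I]) (auto intro!: holomorphic_intros)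
    qed
    have "norm (\<Sum>n\<in>I. \<Phi>B (\<lambda>x. 1 / pochhammer x n) ** mat_scale (pochhammer a n * (t ^ n / fact n)) (mat_pow Y n))
        \<le> LB * (KY * C)" if a: "a \<in> DA" for a
      unfolding LB_def
    proof (rule B.calc_weighted_bound[OF I])
      show "(\<lambda>x. 1 / pochhammer x n) holomorphic_on right_half_plane" for n
        by (intro holomorphic_intros B.holomorphic_pochhammer) (simp add: pochhammer_nonzero)
      fix b assume "b \<in> DB"
      then show "norm (\<Sum>n\<in>I. mat_scale (1 / pochhammer b n) (mat_scale (pochhammer a n * (t ^ n / fact n)) (mat_pow Y n)))
          \<le> KY * C"
        using 1[OF a] by (simp only: calcY)
    qed
    then have 2: "norm (\<Sum>n\<in>I. mat_scale (pochhammer a n) (mat_scale (t ^ n / fact n) (\<Phi>B (\<lambda>x. 1 / pochhammer x n) ** mat_pow Y n)))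
        \<le> LB * (KY * C)" if "a \<in> DA" for a
      using that by simp
    show ?thesis
      unfolding trm LA_def
      by (rule A.calc_weighted_bound[OF I]) (rule A.holomorphic_pochhammer, rule 2)
  qed
  moreover have "LA * (LB * KY) \<ge> 0"
    by (simp add: LA_def LB_def A.K_nonneg B.K_nonneg Y.K_nonneg)
  ultimately show ?thesis
    by (intro exI[of _ "LA * (LB * KY)"] conjI allI impI) (simp_all add: mult.assoc)
qed

text \<open>The constant \<open>K\<close> of the partial sum estimate is independent of
  \<open>s\<close>. For fixed \<open>s\<close>, scalar partial sums differ from the Kummer function
  by a tail that is uniform in \<open>a\<close>, \<open>b\<close>, \<open>y\<close>. The tail
  depends on \<open>s\<close>, but it vanishes as \<open>N\<close> grows and leaves the bound
  \<open>K * C\<close>.\<close>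

lemma mat_1F1_bounded_on_ray:
  fixes A B Y :: "complex^'n^'n"
  assumes "positive_stable A" "positive_stable B" "positive_stable Y"
  shows "\<exists>C. \<forall>s\<ge>0. norm (mat_1F1 A B (mat_scale (- of_real s) Y)) \<le> C"
proof -
  obtain \<Phi>A DA KA where A: "holomorphic_calculus A \<Phi>A DA KA"
    by (rule ex_holomorphic_calculus[OF assms(1)])
  obtain \<Phi>B DB KB where B: "holomorphic_calculus B \<Phi>B DB KB"
    by (rule ex_holomorphic_calculus[OF assms(2)])
  obtain \<Phi>Y DY KY where Y: "holomorphic_calculus Y \<Phi>Y DY KY"
    by (rule ex_holomorphic_calculus[OF assms(3)])
  obtain K where K: "K \<ge> 0" "\<forall>I t C. finite I
    \<longrightarrow> (\<forall>a\<in>DA. \<forall>b\<in>DB. \<forall>y\<in>DY. norm (\<Sum>n\<in>I. kummer_coeff a b n * (t * y) ^ n) \<le> C)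
    \<longrightarrow> norm (\<Sum>n\<in>I. mat_1F1_term A B (mat_scale t Y) n) \<le> K * C"
    using norm_mat_1F1_partial_sum_le[OF A B Y] by (elim exE conjE)
  have "compact (DA \<union> DB \<union> DY)" "DA \<union> DB \<union> DY \<subseteq> right_half_plane"
    using A B Y by (auto simp: holomorphic_calculus_def)
  then obtain \<epsilon> R where eps: "\<epsilon> > 0" and D: "\<And>x. x \<in> DA \<union> DB \<union> DY \<Longrightarrow> \<epsilon> \<le> Re x" "\<And>x. x \<in> DA \<union> DB \<union> DY \<Longrightarrow> norm x \<le> R"
    by (rule compact_right_half_plane_bounds) (rule that)
  obtain C where C: "\<forall>a b y s. \<epsilon> \<le> Re a \<and> norm a \<le> R \<and> \<epsilon> \<le> Re b \<and> norm b \<le> R \<and> \<epsilon> \<le> Re y \<and> norm y \<le> R \<and> 0 \<le> s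
    \<longrightarrow> norm (kummer a b (- (of_real s * y))) \<le> C"
    using kummer_bounded_on_rays[OF eps, of R] by (elim exE)
  have "norm (mat_1F1 A B (mat_scale (- of_real s) Y)) \<le> K * C" if s: "s \<ge> 0" for s
  proof -
    define c where "c = (\<lambda>n. (kummer_rate \<epsilon> R * (s * R)) ^ n /\<^sub>R fact n)"
    have c: "summable c"
      unfolding c_def by (rule summable_exp_generic)
    let ?t = "- complex_of_real s"
    have term_le: "norm (kummer_coeff a b n * (?t * y) ^ n) \<le> c n" if "a \<in> DA" "b \<in> DB" "y \<in> DY" for a b y n
      unfolding c_def
      by (rule norm_kummer_term_le) (use that D eps s in \<open>auto simp: norm_mult intro!: mult_left_mono\<close>)
    have "norm (\<Sum>n<N. mat_1F1_term A B (mat_scale ?t Y) n) \<le> K * (C + (suminf c - (\<Sum>n<N. c n)))" for N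
    proof (rule K(2)[rule_format])
      fix a b y assume ab: "a \<in> DA" "b \<in> DB" "y \<in> DY"
      have "norm (kummer a b (?t * y)) \<le> C"
        using C[rule_format, of a b y s] ab D s by simp
      moreover have "norm (kummer a b (?t * y) - (\<Sum>n<N. kummer_coeff a b n * (?t * y) ^ n)) \<le> suminf c - (\<Sum>n<N. c n)"
        unfolding kummer_def by (rule suminf_tail_bound[OF term_le[OF ab] c])
      ultimately show "norm (\<Sum>n<N. kummer_coeff a b n * (?t * y) ^ n) \<le> C + (suminf c - (\<Sum>n<N. c n))"
        using norm_triangle_sub[of "\<Sum>n<N. kummer_coeff a b n * (?t * y) ^ n" "kummer a b (?t * y)"]
        by (simp add: norm_minus_commute)
    qed simp
    \<comment> \<open>The estimate holds for every finite index set; singletons bound the individual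
      terms and give absolute convergence.\<close>
    moreover have "summable (mat_1F1_term A B (mat_scale ?t Y))"
    proof (rule summable_comparison_test'[OF summable_mult[OF c, of K]])
      fix n
      have "norm (\<Sum>n\<in>{n}. mat_1F1_term A B (mat_scale ?t Y) n) \<le> K * c n"
        by (rule K(2)[rule_format]) (use term_le in simp_all)
      then show "norm (mat_1F1_term A B (mat_scale ?t Y) n) \<le> K * c n"
        by simp
    qed
    then have "(\<lambda>N. norm (\<Sum>n<N. mat_1F1_term A B (mat_scale ?t Y) n)) \<longlonglongrightarrow> norm (mat_1F1 A B (mat_scale ?t Y))"
      unfolding mat_1F1_def mat_1F1_term_def by (intro tendsto_norm summable_LIMSEQ)
    moreover have "(\<lambda>N. K * (C + (suminf c - (\<Sum>n<N. c n)))) \<longlonglongrightarrow> K * (C + 0)"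
      by (intro tendsto_intros tail_tendsto_zero c)
    ultimately show ?thesis
      by (simp add: LIMSEQ_le)
  qed
  then show ?thesis
    by blast
qed

subsection \<open>Matrix powers, the binomial series and integrability\<close>

lemma norm_pochhammer_le_pochhammer_norm:
  fixes x :: complex
  assumes "norm x \<le> R"
  shows "norm (pochhammer x n) \<le> pochhammer R n"
proof (induction n)
  case (Suc n)
  have "norm (x + of_nat n) \<le> R + real n"
    using norm_triangle_ineq[of x "of_nat n"] assms by simp
  then have "norm (pochhammer x n) * norm (x + of_nat n) \<le> pochhammer R n * (R + real n)"
    using Suc.IH order_trans[OF norm_ge_zero Suc.IH] by (intro mult_mono) simp_all
  then show ?case
    by (simp add: pochhammer_Suc norm_mult)
qed simp

text \<open>Brings the binomial series of \<open>(1 - v) powr (- x)\<close> into the Pochhammer form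
  of the Appell terms; the two signs \<open>(-1) ^ n\<close> cancel.\<close>

lemma gbinomial_minus_mult_power_minus:
  fixes x v :: "'a :: field_char_0"
  shows "((- x) gchoose n) * (- v) ^ n = v ^ n / fact n * pochhammer x n"
proof -
  have "((- x) gchoose n) * (- v) ^ n = ((- 1) ^ n * (- 1) ^ n) * (v ^ n / fact n * pochhammer x n)"
    unfolding gbinomial_pochhammer power_minus[of v] minus_minus by (simp add: mult_ac)
  also have "(- 1) ^ n * (- 1) ^ n = (1 :: 'a)"
    by (simp flip: power_mult_distrib)
  finally show ?thesis
    by simp
qed

lemma summable_pochhammer_power:
  fixes R r :: real
  assumes "0 \<le> r" "r < 1"
  shows "summable (\<lambda>n. r ^ n / fact n * pochhammer R n)"
proof -
  have "(\<lambda>n. ((- R) gchoose n) * (- r) ^ n) sums (1 + (- r)) powr (- R)"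
    by (rule gen_binomial_real) (use assms in simp)
  moreover have "((- R) gchoose n) * (- r) ^ n = r ^ n / fact n * pochhammer R n" for n
    by (rule gbinomial_minus_mult_power_minus)
  ultimately show ?thesis
    by (simp add: sums_iff)
qed

lemma pochhammer_power_sums:
  fixes x v :: complex
  assumes "norm v < 1"
  shows "(\<lambda>n. v ^ n / fact n * pochhammer x n) sums exp (- Ln (1 - v) * x)"
proof -
  have "(\<lambda>n. ((- x) gchoose n) * (- v) ^ n) sums (1 + (- v)) powr (- x)"
    by (rule gen_binomial_complex) (use assms in simp)
  moreover have "((- x) gchoose n) * (- v) ^ n = v ^ n / fact n * pochhammer x n" for n
    by (rule gbinomial_minus_mult_power_minus)
  moreover have "1 - v \<noteq> 0"
    using assms by auto
  ultimately show ?thesis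
    by (simp add: powr_def mult.commute)
qed

context holomorphic_calculus
begin

lemma D_bounds:
  obtains \<epsilon> R where "\<epsilon> > 0" "\<And>x. x \<in> D \<Longrightarrow> \<epsilon> \<le> Re x" "\<And>x. x \<in> D \<Longrightarrow> norm x \<le> R"
  by (rule compact_right_half_plane_bounds[OF compact_D D_subset]) (rule that)

text \<open>The shift \<open>c\<close> lets the calculus of \<open>M\<close> alone serve the
  exponents \<open>M - I\<close> and \<open>M + k I - I\<close>, and also \<open>- M\<close>, by
  \<open>c = 0\<close> and a sign in \<open>t\<close>.\<close>

lemma mat_exp_eq_calc: "mat_exp (mat_scale t (M + mat c)) = \<Phi> (\<lambda>x. exp (t * (x + c)))"
proof -
  obtain \<epsilon> R where R: "\<And>x. x \<in> D \<Longrightarrow> norm x \<le> R"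
    by (rule D_bounds) (rule that)
  define b where "b = (\<lambda>n. (norm t * (R + norm c)) ^ n /\<^sub>R fact n)"
  have "(\<lambda>n. \<Phi> (\<lambda>x. (t ^ n / fact n) * (x + c) ^ n)) sums \<Phi> (\<lambda>x. exp (t * (x + c)))"
  proof (rule calc_sums)
    show "summable b"
      unfolding b_def by (rule summable_exp_generic)
    fix n x assume x: "x \<in> D"
    have "norm (x + c) \<le> R + norm c"
      using norm_triangle_ineq[of x c] R[OF x] by simp
    then have "(norm t * norm (x + c)) ^ n \<le> (norm t * (R + norm c)) ^ n"
      by (intro power_mono mult_left_mono) simp_all
    then show "norm ((t ^ n / fact n) * (x + c) ^ n) \<le> b n"
      by (simp add: b_def norm_mult norm_divide norm_power power_mult_distrib divide_simps)
  next
    fix x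
    have "(\<lambda>n. (t * (x + c)) ^ n /\<^sub>R fact n) sums exp (t * (x + c))"
      by (rule exp_converges)
    then show "(\<lambda>n. (t ^ n / fact n) * (x + c) ^ n) sums exp (t * (x + c))"
      by (simp add: scaleR_conv_of_real power_mult_distrib divide_inverse mult_ac)
  qed (intro holomorphic_intros)+
  moreover have "\<Phi> (\<lambda>x. (t ^ n / fact n) * (x + c) ^ n) = mat_pow (mat_scale t (M + mat c)) n /\<^sub>R fact n" for n
  proof -
    have "\<Phi> (\<lambda>x. (t ^ n / fact n) * (x + c) ^ n) = mat_scale (t ^ n / fact n) (\<Phi> (\<lambda>x. (x + c) ^ n))"
      by (rule calc_cmult) (intro holomorphic_intros)
    then show ?thesis
      by (simp add: calc_power_shift mat_pow_scale scaleR_eq_mat_scale divide_inverse mult.commute)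
  qed
  ultimately show ?thesis
    by (simp add: mat_exp_def sums_iff)
qed

text \<open>Both powers are images under one \<open>\<Phi>\<close> of functions that differ by the
  scalar factor \<open>u ^ k\<close>, so linearity suffices.\<close>

lemma mat_cpow_add_of_nat:
  assumes "u > 0"
  shows "mat_cpow (of_real u) (M + mat (of_nat k) - mat 1) = mat_scale (of_real (u ^ k)) (mat_cpow (of_real u) (M - mat 1))"
proof -
  have shift: "M + mat (of_nat k) - mat 1 = M + mat (of_nat k - 1)" "M - mat 1 = M + mat (- 1)"
    by (simp_all add: mat_def vec_eq_iff)
  have "exp (Ln (of_real u) * (x + (of_nat k - 1))) = of_real (u ^ k) * exp (Ln (of_real u) * (x + - 1))" for x
  proof -
    have "Ln (of_real u) * (x + (of_nat k - 1)) = of_nat k * Ln (of_real u) + Ln (of_real u) * (x + - 1)"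
      by (simp add: algebra_simps)
    then show ?thesis
      using assms by (simp only: exp_add exp_of_nat_mult) simp
  qed
  then show ?thesis
    unfolding mat_cpow_def shift mat_exp_eq_calc
    by (simp only:) (rule calc_cmult, intro holomorphic_intros)
qed

text \<open>Here \<open>\<epsilon>\<close> is a lower bound for the real parts on \<open>D\<close>.
  As \<open>ln u < 0\<close>, the modulus \<open>u powr (Re x - 1)\<close> is at most
  \<open>u powr (\<epsilon> - 1)\<close>, which is integrable at \<open>0\<close> because
  \<open>\<epsilon> > 0\<close>.\<close>

lemma norm_mat_cpow_le:
  obtains \<epsilon> where "\<epsilon> > 0"
    "\<And>u. 0 < u \<Longrightarrow> u < 1 \<Longrightarrow> norm (mat_cpow (of_real u) (M - mat 1)) \<le> K * u powr (\<epsilon> - 1)"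
proof -
  obtain \<epsilon> where eps: "\<epsilon> > 0" "\<And>x. x \<in> D \<Longrightarrow> \<epsilon> \<le> Re x"
    by (rule D_bounds) (rule that)
  have shift: "M - mat 1 = M + mat (- 1)"
    by (simp add: mat_def vec_eq_iff)
  have "norm (mat_cpow (of_real u) (M - mat 1)) \<le> K * u powr (\<epsilon> - 1)" if u: "0 < u" "u < 1" for u
    unfolding mat_cpow_def shift mat_exp_eq_calc
  proof (rule calc_bound)
    fix x assume "x \<in> D"
    then have "ln u * (Re x - 1) \<le> ln u * (\<epsilon> - 1)"
      using u eps(2) by (intro mult_left_mono_neg) simp_all
    then show "norm (exp (Ln (of_real u) * (x + - 1))) \<le> u powr (\<epsilon> - 1)"
      using u by (simp add: Ln_of_real powr_def mult.commute)
  qed (intro holomorphic_intros)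
  then show ?thesis
    by (rule that[OF eps(1)])
qed

lemma summable_norm_mat_poch:
  assumes "0 \<le> r" "r < 1"
  shows "summable (\<lambda>n. r ^ n / fact n * norm (mat_poch M n))"
proof -
  obtain \<epsilon> R where R: "\<And>x. x \<in> D \<Longrightarrow> norm x \<le> R"
    by (rule D_bounds) (rule that)
  show ?thesis
  proof (rule summable_comparison_test'[OF summable_mult[OF summable_pochhammer_power[OF assms, of R], of K]])
    fix n
    have "norm (mat_poch M n) \<le> K * pochhammer R n"
      unfolding calc_pochhammer[symmetric]
      by (rule calc_bound[OF holomorphic_pochhammer norm_pochhammer_le_pochhammer_norm[OF R]])
    moreover have r: "0 \<le> r ^ n / fact n"
      using assms by simp
    ultimately have "r ^ n / fact n * norm (mat_poch M n) \<le> r ^ n / fact n * (K * pochhammer R n)"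
      by (rule mult_left_mono)
    also have "\<dots> = K * (r ^ n / fact n * pochhammer R n)"
      by (rule mult.left_commute)
    finally show "norm (r ^ n / fact n * norm (mat_poch M n)) \<le> K * (r ^ n / fact n * pochhammer R n)"
      using r by (simp only: real_norm_def abs_mult abs_norm_cancel abs_of_nonneg)
  qed
qed

text \<open>The image of the scalar binomial series of \<open>(1 - v) powr (- x)\<close>, which on
  \<open>D\<close> is majorized by the same series at the real parameter \<open>R\<close> and the
  point \<open>norm v < 1\<close>.\<close>

lemma mat_binomial_sums:
  assumes "norm v < 1"
  shows "(\<lambda>n. mat_scale (v ^ n / fact n) (mat_poch M n)) sums mat_cpow (1 - v) (- M)"
proof -
  obtain \<epsilon> R where R: "\<And>x. x \<in> D \<Longrightarrow> norm x \<le> R"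
    by (rule D_bounds) (rule that)
  have neg: "mat_scale (Ln (1 - v)) (- M) = mat_scale (- Ln (1 - v)) (M + mat 0)"
    by (simp add: ms.minus_left ms.minus_right)
  have "(\<lambda>n. \<Phi> (\<lambda>x. (v ^ n / fact n) * pochhammer x n)) sums \<Phi> (\<lambda>x. exp (- Ln (1 - v) * (x + 0)))"
  proof (rule calc_sums)
    show "summable (\<lambda>n. norm v ^ n / fact n * pochhammer R n)"
      by (rule summable_pochhammer_power) (use assms in simp_all)
    fix n x assume x: "x \<in> D"
    have "norm (v ^ n / fact n) = norm v ^ n / fact n"
      by (simp add: norm_divide norm_power)
    moreover have "norm v ^ n / fact n * norm (pochhammer x n) \<le> norm v ^ n / fact n * pochhammer R n"
      by (rule mult_left_mono[OF norm_pochhammer_le_pochhammer_norm[OF R[OF x]]]) simp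
    ultimately show "norm ((v ^ n / fact n) * pochhammer x n) \<le> norm v ^ n / fact n * pochhammer R n"
      by (simp only: norm_mult)
  next
    show "(\<lambda>n. (v ^ n / fact n) * pochhammer x n) sums exp (- Ln (1 - v) * (x + 0))" for x
      using pochhammer_power_sums[OF assms, of x] by simp
  qed (intro holomorphic_intros holomorphic_pochhammer)+
  moreover have "\<Phi> (\<lambda>x. (v ^ n / fact n) * pochhammer x n) = mat_scale (v ^ n / fact n) (mat_poch M n)" for n
    using calc_cmult[OF holomorphic_pochhammer, of "v ^ n / fact n" n] by (simp add: calc_pochhammer)
  ultimately show ?thesis
    unfolding mat_cpow_def neg mat_exp_eq_calc by simp
qed

end

section \<open>Measurability and dominated integration\<close>

lemma borel_measurable_matrix_mult [measurable]:
  fixes f g :: "'a \<Rightarrow> complex^'n^'n"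
  assumes [measurable]: "f \<in> borel_measurable N" "g \<in> borel_measurable N"
  shows "(\<lambda>x. f x ** g x) \<in> borel_measurable N"
proof (rule borel_measurable_continuous_Pair[OF assms])
  show "continuous_on UNIV (\<lambda>x. fst x ** snd x :: complex^'n^'n)"
    by (intro mm.continuous_on continuous_intros)
qed

lemma borel_measurable_mat_scale [measurable]:
  fixes g :: "'a \<Rightarrow> complex^'n^'n"
  assumes [measurable]: "f \<in> borel_measurable N" "g \<in> borel_measurable N"
  shows "(\<lambda>x. mat_scale (f x) (g x)) \<in> borel_measurable N"
proof (rule borel_measurable_continuous_Pair[OF assms])
  show "continuous_on UNIV (\<lambda>x. mat_scale (fst x) (snd x) :: complex^'n^'n)"
    by (intro ms.continuous_on continuous_intros)
qed

lemma borel_measurable_mat_pow [measurable]: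
  fixes f :: "'a \<Rightarrow> complex^'n^'n"
  assumes [measurable]: "f \<in> borel_measurable N"
  shows "(\<lambda>x. mat_pow (f x) n) \<in> borel_measurable N"
  by (induction n) simp_all

lemma borel_measurable_mat_exp [measurable]:
  fixes f :: "'a \<Rightarrow> complex^'n^'n"
  assumes [measurable]: "f \<in> borel_measurable N"
  shows "(\<lambda>x. mat_exp (f x)) \<in> borel_measurable N"
  unfolding mat_exp_def by measurable

lemma borel_measurable_mat_1F1 [measurable]:
  fixes f :: "'a \<Rightarrow> complex^'n^'n"
  assumes [measurable]: "f \<in> borel_measurable N"
  shows "(\<lambda>x. mat_1F1 A B (f x)) \<in> borel_measurable N"
  unfolding mat_1F1_def by measurable

text \<open>The hypergeometric factor is bounded, by \<open>mat_1F1_bounded_on_ray\<close> at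
  \<open>s = 1 / (u * (1 - u))\<close>. The majorants of the two powers multiply to the integrand of
  a scalar beta function with parameters \<open>\<alpha>, \<beta> > 0\<close>.\<close>

lemma set_integrable_ext_Beta_integrand:
  fixes A B Y P Q :: "complex^'n^'n"
  assumes "positive_stable A" "positive_stable B" "positive_stable Y" "positive_stable P" "positive_stable Q"
  shows "set_integrable lborel {0<..<1} (ext_Beta_integrand A B Y P Q)"
proof -
  obtain \<Phi>P DP KP where P: "holomorphic_calculus P \<Phi>P DP KP"
    by (rule ex_holomorphic_calculus[OF assms(4)])
  obtain \<Phi>Q DQ KQ where Q: "holomorphic_calculus Q \<Phi>Q DQ KQ"
    by (rule ex_holomorphic_calculus[OF assms(5)])
  obtain \<alpha> where \<alpha>: "\<alpha> > 0"
    "\<And>u. 0 < u \<Longrightarrow> u < 1 \<Longrightarrow> norm (mat_cpow (of_real u) (P - mat 1)) \<le> KP * u powr (\<alpha> - 1)"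
    by (rule holomorphic_calculus.norm_mat_cpow_le[OF P]) (rule that)
  obtain \<beta> where \<beta>: "\<beta> > 0"
    "\<And>u. 0 < u \<Longrightarrow> u < 1 \<Longrightarrow> norm (mat_cpow (of_real u) (Q - mat 1)) \<le> KQ * u powr (\<beta> - 1)"
    by (rule holomorphic_calculus.norm_mat_cpow_le[OF Q]) (rule that)
  obtain C where C: "\<forall>s\<ge>0. norm (mat_1F1 A B (mat_scale (- of_real s) Y)) \<le> C"
    using mat_1F1_bounded_on_ray[OF assms(1,2,3)] by (elim exE)
  obtain k where k: "k > 0" "\<And>X Z. norm ((X :: complex^'n^'n) ** (Z :: complex^'n^'n)) \<le> norm X * norm Z * k"
    using mm.pos_bounded[where 'n = 'n and 'm = 'n and 'k = 'n] by (elim exE conjE) blast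
  have KP: "KP \<ge> 0" and KQ: "KQ \<ge> 0"
    by (rule holomorphic_calculus.K_nonneg[OF P] holomorphic_calculus.K_nonneg[OF Q])+
  \<comment> \<open>\<open>H\<close> has real logarithms in place of complex ones, which makes its
    measurability on the whole line immediate; it agrees with the integrand on the open
    interval.\<close>
  define H where "H = (\<lambda>u :: real. mat_1F1 A B (- (Y /\<^sub>R (u * (1 - u))))
      ** mat_exp (mat_scale (of_real (ln u)) (P - mat 1)) ** mat_exp (mat_scale (of_real (ln (1 - u))) (Q - mat 1)))"
  have eq: "ext_Beta_integrand A B Y P Q u = H u" if "u \<in> {0<..<1}" for u
    using that Ln_of_real[of u] Ln_of_real[of "1 - u"]
    by (simp add: ext_Beta_integrand_def H_def mat_cpow_def del: of_real_diff)
  let ?b = "\<lambda>u. C * (KP * u powr (\<alpha> - 1)) * k * (KQ * (1 - u) powr (\<beta> - 1)) * k"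
  have bound: "norm (H u) \<le> ?b u" if "u \<in> {0<..<1}" for u
  proof -
    have u: "0 < u" "u < 1"
      using that by simp_all
    have "- (Y /\<^sub>R (u * (1 - u))) = mat_scale (- of_real (inverse (u * (1 - u)))) Y"
      by (simp only: scaleR_eq_mat_scale ms.minus_left)
    then have "norm (mat_1F1 A B (- (Y /\<^sub>R (u * (1 - u))))) \<le> C"
      using u by (simp only:) (rule C[rule_format], simp)
    moreover have "norm (mat_1F1 A B (- (Y /\<^sub>R (u * (1 - u)))) ** mat_cpow (of_real u) (P - mat 1))
        \<le> norm (mat_1F1 A B (- (Y /\<^sub>R (u * (1 - u))))) * norm (mat_cpow (of_real u) (P - mat 1)) * k"
      by (rule k(2))
    moreover have "\<dots> \<le> C * (KP * u powr (\<alpha> - 1)) * k"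
      using calculation(1) \<alpha>(2)[OF u] k(1) order_trans[OF norm_ge_zero calculation(1)]
      by (intro mult_right_mono mult_mono) simp_all
    ultimately have 1: "norm (mat_1F1 A B (- (Y /\<^sub>R (u * (1 - u)))) ** mat_cpow (of_real u) (P - mat 1))
        \<le> C * (KP * u powr (\<alpha> - 1)) * k"
      by linarith
    have "norm (ext_Beta_integrand A B Y P Q u)
        \<le> norm (mat_1F1 A B (- (Y /\<^sub>R (u * (1 - u)))) ** mat_cpow (of_real u) (P - mat 1))
          * norm (mat_cpow (of_real (1 - u)) (Q - mat 1)) * k"
      unfolding ext_Beta_integrand_def by (rule k(2))
    also have "\<dots> \<le> ?b u"
      using 1 \<beta>(2)[of "1 - u"] u k(1) order_trans[OF norm_ge_zero 1]
      by (intro mult_right_mono mult_mono) simp_all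
    finally show ?thesis
      by (simp only: eq[OF that])
  qed
  have "set_integrable lborel {0..1} (\<lambda>t. t powr (\<alpha> - 1) * (1 - t) powr (\<beta> - 1))"
    by (rule integrable_Beta[OF \<alpha>(1) \<beta>(1)])
  then have "set_integrable lborel {0<..<1} (\<lambda>t. t powr (\<alpha> - 1) * (1 - t) powr (\<beta> - 1))"
    by (rule set_integrable_subset) auto
  then have "integrable lborel (\<lambda>u. (C * KP * k * KQ * k) * (indicator {0<..<1} u *\<^sub>R (u powr (\<alpha> - 1) * (1 - u) powr (\<beta> - 1))))"
    unfolding set_integrable_def by (rule integrable_mult_right)
  then have "integrable lborel (\<lambda>u. indicator {0<..<1} u *\<^sub>R H u)"
  proof (rule Bochner_Integration.integrable_bound)
    show "(\<lambda>u. indicator {0<..<1} u *\<^sub>R H u) \<in> borel_measurable lborel"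
      unfolding H_def by measurable
    show "AE u in lborel. norm (indicator {0<..<1} u *\<^sub>R H u)
        \<le> norm ((C * KP * k * KQ * k) * (indicator {0<..<1} u *\<^sub>R (u powr (\<alpha> - 1) * (1 - u) powr (\<beta> - 1))))"
    proof (rule AE_I2)
      fix u :: real
      show "norm (indicator {0<..<1} u *\<^sub>R H u)
        \<le> norm ((C * KP * k * KQ * k) * (indicator {0<..<1} u *\<^sub>R (u powr (\<alpha> - 1) * (1 - u) powr (\<beta> - 1))))"
      proof (cases "u \<in> {0<..<1}")
        case True
        have "norm (H u) \<le> \<bar>?b u\<bar>"
          using bound[OF True] by linarith
        also have "?b u = (C * KP * k * KQ * k) * (u powr (\<alpha> - 1) * (1 - u) powr (\<beta> - 1))"
          by (simp only: mult_ac)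
        finally show ?thesis
          using True by simp
      qed simp
    qed
  qed
  moreover have "(\<lambda>u. indicator {0<..<1} u *\<^sub>R H u) = (\<lambda>u. indicator {0<..<1} u *\<^sub>R ext_Beta_integrand A B Y P Q u)"
  proof (rule ext)
    show "indicator {0<..<1} u *\<^sub>R H u = indicator {0<..<1} u *\<^sub>R ext_Beta_integrand A B Y P Q u" for u
      by (cases "u \<in> {0<..<1}") (simp_all add: eq del: greaterThanLessThan_iff)
  qed
  ultimately show ?thesis
    by (simp add: set_integrable_def)
qed

text \<open>Termwise integration is available for sequences, so \<open>prod_decode\<close>
  enumerates the pairs. The integrals of the norms are at most \<open>c i\<close> times the integral
  of \<open>norm (g x)\<close>, and this absolute convergence allows the return to an unordered
  sum.\<close>

lemma dominated_has_sum_integral: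
  fixes f :: "nat \<times> nat \<Rightarrow> 'a \<Rightarrow> 'b :: {banach, second_countable_topology}" and g :: "'a \<Rightarrow> 'b"
  assumes f: "\<And>i. integrable N (f i)" and g: "integrable N g" and c: "c summable_on UNIV"
    and le: "\<And>i x. norm (f i x) \<le> c i * norm (g x)"
    and F: "\<And>x. ((\<lambda>i. f i x) has_sum F x) UNIV"
  shows "integrable N F" and "((\<lambda>i. integral\<^sup>L N (f i)) has_sum integral\<^sup>L N F) UNIV"
proof -
  let ?d = "prod_decode"
  have bij: "bij_betw ?d UNIV UNIV"
    by (rule bij_prod_decode)
  have c_nonneg: "c i * norm (g x) \<ge> 0" for i x
    by (rule order_trans[OF norm_ge_zero[of "f i x"] le[of i x]])
  have c': "(\<lambda>n. c (?d n)) summable_on UNIV"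
    using c by (rule iffD2[OF summable_on_reindex_bij_betw[OF bij, of c]])
  then have sc: "summable (\<lambda>n. c (?d n))"
    by (rule summable_on_imp_summable)
  have sn: "summable (\<lambda>n. norm (f (?d n) x))" for x
    by (rule summable_comparison_test'[OF summable_mult2[OF sc, of "norm (g x)"], of 0]) (simp add: le)
  have si: "summable (\<lambda>n. \<integral>x. norm (f (?d n) x) \<partial>N)"
  proof (rule summable_comparison_test'[OF summable_mult2[OF sc, of "\<integral>x. norm (g x) \<partial>N"], of 0])
    fix n
    have "(\<integral>x. norm (f (?d n) x) \<partial>N) \<le> (\<integral>x. c (?d n) * norm (g x) \<partial>N)"
      by (intro integral_mono integrable_mult_right integrable_norm f g le)
    then show "norm (\<integral>x. norm (f (?d n) x) \<partial>N) \<le> c (?d n) * (\<integral>x. norm (g x) \<partial>N)"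
      by simp
  qed
  have "((\<lambda>n. f (?d n) x) has_sum F x) UNIV" for x
    using F[of x] by (rule iffD2[OF has_sum_reindex_bij_betw[OF bij, of "\<lambda>i. f i x"]])
  then have F_eq: "F = (\<lambda>x. \<Sum>n. f (?d n) x)"
    by (intro ext sums_unique has_sum_imp_sums)
  show "integrable N F"
    unfolding F_eq by (rule integrable_suminf[OF f _ si]) (simp add: sn)
  have "(\<lambda>n. integral\<^sup>L N (f (?d n))) sums integral\<^sup>L N F"
    unfolding F_eq by (rule sums_integral[OF f _ si]) (simp add: sn)
  moreover have "summable (\<lambda>n. norm (integral\<^sup>L N (f (?d n))))"
    by (rule summable_comparison_test'[OF si, of 0]) (simp add: integral_norm_bound)
  ultimately have "((\<lambda>n. integral\<^sup>L N (f (?d n))) has_sum integral\<^sup>L N F) UNIV"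
    by (intro norm_summable_imp_has_sum)
  then show "((\<lambda>i. integral\<^sup>L N (f i)) has_sum integral\<^sup>L N F) UNIV"
    by (rule iffD1[OF has_sum_reindex_bij_betw[OF bij, of "\<lambda>i. integral\<^sup>L N (f i)"]])
qed

subsection \<open>The integral representation\<close>

text \<open>Up to a constant, \<open>norm (X m) * norm (Z n)\<close> gives absolute summability over
  pairs. The value may then be computed as an iterated sum, where multiplication by a fixed matrix
  is bounded and linear.\<close>

lemma matrix_mult_has_sum_product:
  fixes Q :: "complex^'n^'n" and X Z :: "nat \<Rightarrow> complex^'n^'n"
  assumes X: "summable (\<lambda>m. norm (X m))" "X sums SX" and Z: "summable (\<lambda>n. norm (Z n))" "Z sums SZ"
  shows "((\<lambda>(m, n). Q ** X m ** Z n) has_sum (Q ** SX ** SZ)) UNIV"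
proof -
  have hX: "(X has_sum SX) UNIV" and hZ: "(Z has_sum SZ) UNIV"
    by (rule norm_summable_imp_has_sum[OF X] norm_summable_imp_has_sum[OF Z])+
  obtain k where k: "k > 0" "\<And>X Z. norm ((X :: complex^'n^'n) ** (Z :: complex^'n^'n)) \<le> norm X * norm Z * k"
    using mm.pos_bounded[where 'n = 'n and 'm = 'n and 'k = 'n] by (elim exE conjE) blast
  have nX: "(\<lambda>m. norm (X m)) summable_on UNIV" and nZ: "(\<lambda>n. norm (Z n)) summable_on UNIV"
    using X(1) Z(1) by (simp_all add: summable_on_UNIV_nonneg_real_iff)
  have "(\<lambda>(m, n). (norm Q * k * k) * norm (X m) * norm (Z n)) summable_on Sigma UNIV (\<lambda>_. UNIV)"
  proof (rule summable_on_SigmaI)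
    show "((\<lambda>n. case (m, n) of (m, n) \<Rightarrow> (norm Q * k * k) * norm (X m) * norm (Z n)) has_sum
        (norm Q * k * k) * norm (X m) * infsum (\<lambda>n. norm (Z n)) UNIV) UNIV" for m
      unfolding prod.case by (rule has_sum_cmult_right[OF has_sum_infsum[OF nZ]])
    show "(\<lambda>m. (norm Q * k * k) * norm (X m) * infsum (\<lambda>n. norm (Z n)) UNIV) summable_on UNIV"
      by (intro summable_on_cmult_left summable_on_cmult_right nX)
  qed (use k(1) in simp)
  then have "(\<lambda>i. norm ((\<lambda>(m, n). Q ** X m ** Z n) i)) summable_on Sigma UNIV (\<lambda>_. UNIV)"
  proof (rule Infinite_Sum.abs_summable_on_comparison_test')
    fix i :: "nat \<times> nat"
    obtain m n where i: "i = (m, n)"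
      by (cases i)
    have "norm (Q ** X m ** Z n) \<le> norm (Q ** X m) * norm (Z n) * k"
      by (rule k(2))
    also have "\<dots> \<le> (norm Q * norm (X m) * k) * norm (Z n) * k"
      using k(1) by (intro mult_right_mono k(2)) simp_all
    also have "\<dots> = (norm Q * k * k) * norm (X m) * norm (Z n)"
      by (simp only: mult_ac)
    finally show "norm (case i of (m, n) \<Rightarrow> Q ** X m ** Z n)
        \<le> (case i of (m, n) \<Rightarrow> (norm Q * k * k) * norm (X m) * norm (Z n))"
      by (simp only: i prod.case)
  qed
  then have summable: "(\<lambda>(m, n). Q ** X m ** Z n) summable_on Sigma UNIV (\<lambda>_. UNIV)"
    by (rule abs_summable_summable)
  have "((\<lambda>(m, n). Q ** X m ** Z n) has_sum (Q ** SX ** SZ)) (Sigma UNIV (\<lambda>_. UNIV))"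
  proof (rule has_sum_SigmaI)
    show "((\<lambda>n. case (m, n) of (m, n) \<Rightarrow> Q ** X m ** Z n) has_sum (Q ** X m ** SZ)) UNIV" for m
      unfolding prod.case by (rule has_sum_bounded_linear[OF mm.bounded_linear_right hZ])
    show "((\<lambda>m. Q ** X m ** SZ) has_sum (Q ** SX ** SZ)) UNIV"
      by (rule has_sum_bounded_linear[OF mm.bounded_linear_left
            has_sum_bounded_linear[OF mm.bounded_linear_right hX]])
  qed (rule summable)
  then show ?thesis
    by simp
qed

theorem theorem5p1:
  fixes A A1 B B1 B2 C1 Y :: "complex ^ 'r ^ 'r" and z w :: complex
  defines "rhs_integrand \<equiv> (\<lambda>u::real.
      mat_1F1 A B (- (Y /\<^sub>R (u * (1 - u))))
        ** mat_cpow (of_real u) (A1 - mat 1) ** mat_cpow (of_real (1 - u)) (C1 - A1 - mat 1)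
        ** matrix_inv (mat_Beta A1 (C1 - A1))
        ** mat_cpow (1 - z * of_real u) (- B1) ** mat_cpow (1 - w * of_real u) (- B2))"
  assumes "positive_stable A" and "positive_stable A1" and "positive_stable B"
    and "positive_stable B1" and "positive_stable B2" and "positive_stable C1"
    and "positive_stable (C1 - A1)" and "positive_stable Y"
    and "A1 ** C1 = C1 ** A1"
    and "norm z < 1" and "norm w < 1"
  shows "(\<forall>m n. set_integrable lborel {0<..<1}
            (ext_Beta_integrand A B Y (A1 + mat (of_nat (m + n))) (C1 - A1)))
       \<and> ext_Appell_F1_term A B A1 B1 B2 C1 z w Y summable_on UNIV
       \<and> set_integrable lborel {0<..<1} rhs_integrand
       \<and> ext_Appell_F1 A B A1 B1 B2 C1 z w Y = (LINT u:{0<..<1}|lborel. rhs_integrand u)"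
proof -
  note st = assms(2-9) and z = assms(11) and w = assms(12)
  obtain \<Phi>1 D1 K1 where cA1: "holomorphic_calculus A1 \<Phi>1 D1 K1"
    by (rule ex_holomorphic_calculus[OF \<open>positive_stable A1\<close>])
  obtain \<Phi>2 D2 K2 where cB1: "holomorphic_calculus B1 \<Phi>2 D2 K2"
    by (rule ex_holomorphic_calculus[OF \<open>positive_stable B1\<close>])
  obtain \<Phi>3 D3 K3 where cB2: "holomorphic_calculus B2 \<Phi>3 D3 K3"
    by (rule ex_holomorphic_calculus[OF \<open>positive_stable B2\<close>])
  obtain k where k: "k > 0" "\<And>X Z. norm ((X :: complex^'r^'r) ** (Z :: complex^'r^'r)) \<le> norm X * norm Z * k"
    using mm.pos_bounded[where 'n = 'r and 'm = 'r and 'k = 'r] by (elim exE conjE) blast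
  let ?I = "indicator {0<..<1 :: real} :: real \<Rightarrow> real"
  \<comment> \<open>Extended by zero, so that estimates by \<open>norm (G u)\<close> hold on the
    whole line; \<open>G\<close> is the one dominating function for all terms.\<close>
  define G where "G = (\<lambda>u. ?I u *\<^sub>R ext_Beta_integrand A B Y A1 (C1 - A1) u)"
  define N where "N = matrix_inv (mat_Beta A1 (C1 - A1))"
  have G: "integrable lborel G"
    using set_integrable_ext_Beta_integrand[OF st(1,3,8,2,7)] by (simp add: G_def set_integrable_def)
  have G_out: "G u = 0" if "u \<notin> {0<..<1}" for u
    using that by (simp add: G_def del: greaterThanLessThan_iff)
  have shift: "(\<lambda>u. ?I u *\<^sub>R ext_Beta_integrand A B Y (A1 + mat (of_nat l)) (C1 - A1) u)
      = (\<lambda>u. mat_scale (of_real (u ^ l)) (G u))" for l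
  proof (rule ext)
    fix u
    show "?I u *\<^sub>R ext_Beta_integrand A B Y (A1 + mat (of_nat l)) (C1 - A1) u = mat_scale (of_real (u ^ l)) (G u)"
    proof (cases "u \<in> {0<..<1}")
      case True
      then have u: "u > 0"
        by simp
      show ?thesis
        unfolding G_def ext_Beta_integrand_def holomorphic_calculus.mat_cpow_add_of_nat[OF cA1 u]
        by (simp add: ms.scaleR_right)
    qed (simp add: G_out ms.zero_right del: greaterThanLessThan_iff)
  qed
  have scaled: "integrable lborel (\<lambda>u. mat_scale (of_real (u ^ l)) (G u))" for l
  proof (rule Bochner_Integration.integrable_bound[OF G])
    show "(\<lambda>u. mat_scale (of_real (u ^ l)) (G u)) \<in> borel_measurable lborel"
      using borel_measurable_integrable[OF G] by measurable
    show "AE u in lborel. norm (mat_scale (of_real (u ^ l)) (G u)) \<le> norm (G u)"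
    proof (rule AE_I2)
      fix u
      show "norm (mat_scale (of_real (u ^ l)) (G u)) \<le> norm (G u)"
      proof (cases "u \<in> {0<..<1}")
        case True
        then have "\<bar>u\<bar> ^ l \<le> 1"
          by (intro power_le_one) simp_all
        then show ?thesis
          by (simp add: norm_mat_scale norm_power mult_left_le_one_le)
      qed (simp add: G_out ms.zero_right del: greaterThanLessThan_iff)
    qed
  qed
  \<comment> \<open>\<open>T i\<close> turns a value of the extended beta function into the Appell
    term of index \<open>i\<close>. As a bounded linear map it commutes with the integral.\<close>
  define T where "T = (\<lambda>(m, n) X. mat_scale (z ^ m * w ^ n / (fact m * fact n)) (X ** N ** mat_poch B1 m ** mat_poch B2 n))"
  have T_linear: "bounded_linear (T i)" for i
    unfolding T_def case_prod_unfold
    by (rule bounded_linear_compose[OF ms.bounded_linear_right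
          bounded_linear_compose[OF mm.bounded_linear_left
            bounded_linear_compose[OF mm.bounded_linear_left mm.bounded_linear_left]]])
  define f where "f = (\<lambda>i u. T i (mat_scale (of_real (u ^ (fst i + snd i))) (G u)))"
  have f_integrable: "integrable lborel (f i)" for i
    unfolding f_def by (rule integrable_bounded_linear[OF T_linear scaled])
  have term_eq: "ext_Appell_F1_term A B A1 B1 B2 C1 z w Y i = integral\<^sup>L lborel (f i)" for i
  proof -
    have "integral\<^sup>L lborel (f i) = T i (\<integral>u. mat_scale (of_real (u ^ (fst i + snd i))) (G u) \<partial>lborel)"
      unfolding f_def by (rule integral_bounded_linear[OF T_linear scaled])
    also have "\<dots> = T i (ext_Beta A B Y (A1 + mat (of_nat (fst i + snd i))) (C1 - A1))"
      unfolding ext_Beta_def set_lebesgue_integral_def shift ..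
    finally show ?thesis
      by (simp add: T_def ext_Appell_F1_term_def case_prod_unfold N_def)
  qed
  define b1 where "b1 = (\<lambda>m. norm z ^ m / fact m * norm (mat_poch B1 m))"
  define b2 where "b2 = (\<lambda>n. norm w ^ n / fact n * norm (mat_poch B2 n))"
  have b1: "summable b1"
    unfolding b1_def by (rule holomorphic_calculus.summable_norm_mat_poch[OF cB1 norm_ge_zero z])
  have b2: "summable b2"
    unfolding b2_def by (rule holomorphic_calculus.summable_norm_mat_poch[OF cB2 norm_ge_zero w])
  have b_nonneg: "b1 m \<ge> 0" "b2 m \<ge> 0" for m
    by (simp_all add: b1_def b2_def)
  \<comment> \<open>The factor \<open>u ^ (m + n)\<close> from the shift of \<open>A1\<close> is
    split between \<open>z ^ m\<close> and \<open>w ^ n\<close>, which produces the terms of the two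
    binomial series.\<close>
  have f_eq: "f (m, n) u = G u ** N ** mat_scale ((z * of_real u) ^ m / fact m) (mat_poch B1 m)
      ** mat_scale ((w * of_real u) ^ n / fact n) (mat_poch B2 n)" for m n u
    unfolding f_def T_def by (simp add: power_mult_distrib power_add mult_ac)
  \<comment> \<open>One factor \<open>k\<close> for each of the three matrix products in
    \<open>f_eq\<close>; \<open>b1\<close> and \<open>b2\<close> contain \<open>norm z\<close> and
    \<open>norm w\<close> without \<open>u\<close>, since \<open>0 < u < 1\<close> wherever
    \<open>G\<close> does not vanish.\<close>
  define c where "c = (\<lambda>(m, n). (norm N * k * k * k) * b1 m * b2 n)"
  have c: "c summable_on UNIV"
  proof -
    have s1: "b1 summable_on UNIV" and s2: "b2 summable_on UNIV"
      using b1 b2 by (simp_all add: summable_on_UNIV_nonneg_real_iff b_nonneg)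
    have "c summable_on Sigma UNIV (\<lambda>_. UNIV)"
    proof (rule summable_on_SigmaI)
      show "((\<lambda>n. c (m, n)) has_sum (norm N * k * k * k) * b1 m * infsum b2 UNIV) UNIV" for m
        unfolding c_def prod.case by (rule has_sum_cmult_right[OF has_sum_infsum[OF s2]])
      show "(\<lambda>m. (norm N * k * k * k) * b1 m * infsum b2 UNIV) summable_on UNIV"
        by (intro summable_on_cmult_left summable_on_cmult_right s1)
    qed (use k(1) in \<open>simp add: c_def b_nonneg\<close>)
    then show ?thesis
      by simp
  qed
  have le: "norm (f i u) \<le> c i * norm (G u)" for i u
  proof -
    obtain m n where i: "i = (m, n)"
      by (cases i)
    show ?thesis
    proof (cases "u \<in> {0<..<1}")
      case True
      let ?X = "mat_scale ((z * of_real u) ^ m / fact m) (mat_poch B1 m)"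
      let ?Z = "mat_scale ((w * of_real u) ^ n / fact n) (mat_poch B2 n)"
      have le_coeff: "norm ((v * of_real u) ^ l / fact l) \<le> norm v ^ l / fact l" for v :: complex and l
        using True by (simp add: norm_divide norm_mult norm_power divide_right_mono power_mono mult_left_le)
      have X: "norm ?X \<le> b1 m"
        unfolding norm_mat_scale b1_def by (intro mult_right_mono le_coeff) simp
      have Z: "norm ?Z \<le> b2 n"
        unfolding norm_mat_scale b2_def by (intro mult_right_mono le_coeff) simp
      have "norm (G u ** N ** ?X ** ?Z) \<le> norm (G u ** N ** ?X) * norm ?Z * k"
        by (rule k(2))
      also have "\<dots> \<le> (norm (G u ** N) * norm ?X * k) * norm ?Z * k"
        using k(1) by (intro mult_right_mono k(2)) simp_all
      also have "\<dots> \<le> ((norm (G u) * norm N * k) * b1 m * k) * b2 n * k"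
        using k(1) by (intro mult_right_mono mult_mono k(2) X Z) (simp_all add: b_nonneg)
      also have "\<dots> = c i * norm (G u)"
        unfolding i c_def prod.case by (simp only: mult_ac)
      finally show ?thesis
        by (simp only: i f_eq)
    qed (simp add: i f_eq G_out ms.zero_right del: greaterThanLessThan_iff)
  qed
  define F where "F = (\<lambda>u. ?I u *\<^sub>R rhs_integrand u)"
  have F: "((\<lambda>i. f i u) has_sum F u) UNIV" for u
  proof (cases "u \<in> {0<..<1}")
    case True
    have lt: "norm (v * of_real u) < 1" if "norm v < 1" for v :: complex
    proof -
      have "norm v * \<bar>u\<bar> \<le> norm v"
        using True by (intro mult_left_le) simp_all
      with that show ?thesis
        by (simp add: norm_mult)
    qed
    let ?X = "\<lambda>m. mat_scale ((z * of_real u) ^ m / fact m) (mat_poch B1 m)"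
    let ?Z = "\<lambda>n. mat_scale ((w * of_real u) ^ n / fact n) (mat_poch B2 n)"
    have nX: "summable (\<lambda>m. norm (?X m))"
      using holomorphic_calculus.summable_norm_mat_poch[OF cB1 norm_ge_zero lt[OF z]]
      by (simp add: norm_mat_scale norm_divide norm_power)
    have nZ: "summable (\<lambda>m. norm (?Z m))"
      using holomorphic_calculus.summable_norm_mat_poch[OF cB2 norm_ge_zero lt[OF w]]
      by (simp add: norm_mat_scale norm_divide norm_power)
    have "((\<lambda>(m, n). (G u ** N) ** ?X m ** ?Z n) has_sum
        ((G u ** N) ** mat_cpow (1 - z * of_real u) (- B1) ** mat_cpow (1 - w * of_real u) (- B2))) UNIV"
      by (rule matrix_mult_has_sum_product[OF nX holomorphic_calculus.mat_binomial_sums[OF cB1 lt[OF z]]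
            nZ holomorphic_calculus.mat_binomial_sums[OF cB2 lt[OF w]]])
    moreover have "(\<lambda>(m, n). (G u ** N) ** ?X m ** ?Z n) = (\<lambda>i. f i u)"
      by (intro ext, clarify) (simp only: f_eq prod.case)
    moreover have "(G u ** N) ** mat_cpow (1 - z * of_real u) (- B1) ** mat_cpow (1 - w * of_real u) (- B2) = F u"
      using True unfolding F_def G_def N_def rhs_integrand_def ext_Beta_integrand_def
      by (simp del: greaterThanLessThan_iff)
    ultimately show ?thesis
      by simp
  next
    case False
    then have "f i u = 0" for i
      by (cases i) (simp add: f_eq G_out ms.zero_right del: greaterThanLessThan_iff)
    moreover have "F u = 0"
      using False by (simp add: F_def del: greaterThanLessThan_iff)
    ultimately show ?thesis
      by simp
  qed
  have sum: "(ext_Appell_F1_term A B A1 B1 B2 C1 z w Y has_sum integral\<^sup>L lborel F) UNIV"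
  proof -
    have "ext_Appell_F1_term A B A1 B1 B2 C1 z w Y = (\<lambda>i. integral\<^sup>L lborel (f i))"
      by (rule ext) (rule term_eq)
    then show ?thesis
      using dominated_has_sum_integral(2)[OF f_integrable G c le F] by simp
  qed
  show ?thesis
  proof (intro conjI allI)
    show "set_integrable lborel {0<..<1} (ext_Beta_integrand A B Y (A1 + mat (of_nat (m + n))) (C1 - A1))" for m n
      unfolding set_integrable_def shift by (rule scaled)
    show "ext_Appell_F1_term A B A1 B1 B2 C1 z w Y summable_on UNIV"
      by (rule has_sum_imp_summable[OF sum])
    show "set_integrable lborel {0<..<1} rhs_integrand"
      using dominated_has_sum_integral(1)[OF f_integrable G c le F] by (simp add: F_def set_integrable_def)
    show "ext_Appell_F1 A B A1 B1 B2 C1 z w Y = (LINT u:{0<..<1}|lborel. rhs_integrand u)"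
      unfolding ext_Appell_F1_def infsumI[OF sum] by (simp add: F_def set_lebesgue_integral_def)
  qed
qed

end
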